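(* Let $\tau>0$ and let $U_h$, $H_h=H^F_h\times H^Z_h\times H^w_h$ be the finite element spaces defined in the context. Suppose that $(v^{n-1}_h,\xi^{n-1}_h)\in U_h\times H_h$ and that $(v^n_h,\xi^n_h)\in U_h\times H_h$ solves the fully-discrete scheme $$\Bigl(\frac{v^n_h-v^{n-1}_h}{\tau},\varphi_h\Bigr)=-\bigl(DG(\xi^n_h),\,D\Phi(F^{n-1}_h)\nabla\varphi_h\bigr)\quad\text{for all }\varphi_h\in U_h,$$ $$\Bigl(\frac{\xi^n_h-\xi^{n-1}_h}{\tau},\psi_h\Bigr)=\bigl(D\Phi(F^{n-1}_h)\nabla v^n_h,\,\psi_h\bigr)\quad\text{for all }\psi_h\in H_h,$$ where $\xi^{j}_h=(F^{j}_h,Z^{j}_h,w^{j}_h)$. Then $$\frac1\tau\bigl(\xi^n_h-\xi^{n-1}_h\bigr)-D\Phi(F^{n-1}_h)\nabla v^n_h=0$$ (as an identity in $L^2(\mathbb{T}^3;\mathbb{R}^{19})$). In particular, $\frac1\tau(F^n_h-F^{n-1}_h)-\nabla v^n_h=0$, and if $F^{n-1}_h$ is a gradient then $F^n_h$ is a gradient.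
   Context: $\mathbb{T}^3$ is the three-dimensional torus; $M^{3\times3}$ is the space of real $3\times 3$ matrices. Indices $i,j,k,\alpha,\beta,\gamma$ (as tensor indices) run over $1,2,3$ and $A,B$ over $1,\dots,19$; repeated indices are summed. $\Phi:M^{3\times3}\to\mathbb{R}^{19}$, $\Phi(F)=(F,\mathrm{cof}\,F,\det F)$, where $(\mathrm{cof}\,F)_{i\alpha}=\tfrac12\varepsilon_{ijk}\varepsilon_{\alpha\beta\gamma}F_{j\beta}F_{k\gamma}$; $\Phi^A$ are its components. $(\cdot,\cdot)$ is the $L^2(\mathbb{T}^3)$ inner product (of vector-valued functions), $DG=(\partial G/\partial\xi_A)_{A}$, and $D\Phi(F)\nabla\varphi$ is the $\mathbb{R}^{19}$-valued function with components $\frac{\partial\Phi^A}{\partial F_{i\alpha}}(F)\,\partial_\alpha\varphi_i$. A matrix field $F$ on $\mathbb{T}^3$ (identified with a periodic field on $\mathbb{R}^3$) is a gradient if $F=\nabla y$, i.e. $F_{i\alpha}=\partial_\alpha y_i$, for some weakly differentiable $y:\mathbb{R}^3\to\mathbb{R}^3$. Assumptions on $G$: $G=G(\xi)=G(F,Z,w):M^{3\times3}\times M^{3\times3}\times\mathbb{R}\cong\mathbb{R}^{19}\to[0,\infty)$ is $C^3$, uniformly convex, and, for some $p\in(6,\infty)$ and positive constants $\kappa,\kappa',\gamma,\gamma',c_1,\dots,c_8$: - $G(\xi)=H(F)+R(\xi)$ with $H\in C^3(M^{3\times3};[0,\infty))$ and $R\in C^3(\mathbb{R}^{19};[0,\infty))$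 strictly convex, $\kappa|F|^{p-2}|z|^2\le z^T\nabla^2H(F)z\le\kappa'|F|^{p-2}|z|^2$ for all $z\in\mathbb{R}^9$, and $\gamma I\le\nabla^2R\le\gamma' I$; - $G(\xi)\ge c_1|F|^p+c_2|Z|^2+c_3|w|^2-c_4$; - $G(\xi)\le c_5(|F|^p+|Z|^2+|w|^2+1)$; - $|G_F|^{p/(p-1)}+|G_Z|^{p/(p-2)}+|G_w|^{p/(p-3)}\le c_6(|F|^p+|Z|^2+|w|^2+1)$; - $|\partial^3H/\partial F_{i\alpha}\partial F_{ml}\partial F_{rs}|\le c_7|F|^{p-3}$ and $|\partial^3R/\partial\xi_A\partial\xi_B\partial\xi_D|\le c_8$. Finite element spaces: $\mathcal{T}_h=\mathcal{T}_h(\mathbb{T}^3)$ is a (finite, conforming, simplicial) triangulation of $\mathbb{T}^3$ with elements $K$, $k\ge1$ is an integer, $\mathcal{P}_m(K)$ is the space of polynomials on $K$ of total degree at most $m$, and $U_h=\{\varphi\in C(\mathbb{T}^3;\mathbb{R}^3):\varphi|_K\in[\mathcal{P}_k(K)]^3\ \forall K\in\mathcal{T}_h\}$, $H^F_h=\{A\in L^2(\mathbb{T}^3;M^{3\times3}):A|_K\in[\mathcal{P}_{k-1}(K)]^9\ \forall K\}$, $H^Z_h=\{B\in L^2(\mathbb{T}^3;M^{3\times3}):B|_K\in[\mathcal{P}_{2(k-1)}(K)]^9\ \forall K\}$, $H^w_h=\{d\in L^2(\mathbb{T}^3):d|_K\in\mathcal{P}_{3(k-1)}(K)\ \forall K\}$.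 Gradients $\nabla v_h$ of $v_h\in U_h$ are taken elementwise (equivalently, weakly). *)

theory Defs
  imports "HOL-Analysis.Analysis"
begin

section \<open>Differential calculus\<close>

definition dir_deriv ::
  "'a::euclidean_space \<Rightarrow> ('a \<Rightarrow> 'b::real_normed_vector) \<Rightarrow> 'a \<Rightarrow> 'b" where
  "dir_deriv u f x = frechet_derivative f (at x) u"

primrec C_k :: "nat \<Rightarrow> ('a::euclidean_space \<Rightarrow> 'b::real_normed_vector) \<Rightarrow> bool" where
  "C_k 0 f \<longleftrightarrow> continuous_on UNIV f"
| "C_k (Suc n) f \<longleftrightarrow> (\<forall>x. f differentiable (at x)) \<and> (\<forall>b\<in>Basis. C_k n (dir_deriv b f))"

definition grad :: "('a::euclidean_space \<Rightarrow> real) \<Rightarrow> 'a \<Rightarrow> 'a" where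
  "grad f x = (\<Sum>b\<in>Basis. dir_deriv b f x *\<^sub>R b)"

definition hessian_form :: "('a::euclidean_space \<Rightarrow> real) \<Rightarrow> 'a \<Rightarrow> 'a \<Rightarrow> real" where
  "hessian_form f x z =
     (\<Sum>a\<in>Basis. \<Sum>b\<in>Basis. (z \<bullet> a) * (z \<bullet> b) * dir_deriv a (dir_deriv b f) x)"

definition strictly_convex :: "('a::real_vector \<Rightarrow> real) \<Rightarrow> bool" where
  "strictly_convex f \<longleftrightarrow>
     (\<forall>x y t. x \<noteq> y \<longrightarrow> 0 < t \<longrightarrow> t < 1 \<longrightarrow>
        f ((1 - t) *\<^sub>R x + t *\<^sub>R y) < (1 - t) * f x + t * f y)"

text \<open>Uniform convexity in the sense usual for \<open>C\<^sup>2\<close> energies: the Hessian is bounded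
  below by a positive multiple of the identity.\<close>

definition uniformly_convex :: "('a::euclidean_space \<Rightarrow> real) \<Rightarrow> bool" where
  "uniformly_convex f \<longleftrightarrow> (\<exists>\<mu>>0. \<forall>x z. \<mu> * (norm z)\<^sup>2 \<le> hessian_form f x z)"


section \<open>Null Lagrangians in dimension three\<close>

text \<open>\<open>F $ i $ \<alpha>\<close> is the entry in row \<open>i\<close> and column \<open>\<alpha>\<close>, and the norm of
  \<open>real^3^3\<close> is the Frobenius norm.  The space of nineteen-component vectors is the Euclidean
  space \<open>state\<close>, whose standard basis consists of the matrix units in each of the
  two matrix slots and of the unit of the scalar slot.\<close>

type_synonym vec3 = "real^3"
type_synonym mat3 = "real^3^3"
type_synonym state = "mat3 \<times> mat3 \<times> real"

definition levi_civita :: "3 \<Rightarrow> 3 \<Rightarrow> 3 \<Rightarrow> real" where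
  "levi_civita i j k =
     (if (i, j, k) \<in> {(1, 2, 3), (2, 3, 1), (3, 1, 2)} then 1
      else if (i, j, k) \<in> {(1, 3, 2), (3, 2, 1), (2, 1, 3)} then -1
      else 0)"

definition cof :: "mat3 \<Rightarrow> mat3" where
  "cof F = (\<chi> i \<alpha>. 1/2 * (\<Sum>j\<in>UNIV. \<Sum>k\<in>UNIV. \<Sum>\<beta>\<in>UNIV. \<Sum>\<gamma>\<in>UNIV.
       levi_civita i j k * levi_civita \<alpha> \<beta> \<gamma> * F $ j $ \<beta> * F $ k $ \<gamma>))"

definition Phi :: "mat3 \<Rightarrow> state" where
  "Phi F = (F, cof F, det F)"

definition matrix_unit :: "3 \<Rightarrow> 3 \<Rightarrow> mat3" where
  "matrix_unit i \<alpha> = axis i (axis \<alpha> 1)"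

definition DPhi :: "mat3 \<Rightarrow> mat3 \<Rightarrow> state" where
  "DPhi F M = (\<Sum>i\<in>UNIV. \<Sum>\<alpha>\<in>UNIV. (M $ i $ \<alpha>) *\<^sub>R dir_deriv (matrix_unit i \<alpha>) Phi F)"


section \<open>Assumptions on the stored energy\<close>

definition stored_energy :: "(state \<Rightarrow> real) \<Rightarrow> bool" where
  "stored_energy G \<longleftrightarrow>
     C_k 3 G \<and> (\<forall>\<xi>. 0 \<le> G \<xi>) \<and> uniformly_convex G \<and>
     (\<exists>(H :: mat3 \<Rightarrow> real) (R :: state \<Rightarrow> real) p \<kappa> \<kappa>' \<gamma> \<gamma>' c1 c2 c3 c4 c5 c6 c7 c8.
        p > 6 \<and> \<kappa> > 0 \<and> \<kappa>' > 0 \<and> \<gamma> > 0 \<and> \<gamma>' > 0 \<and>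
        c1 > 0 \<and> c2 > 0 \<and> c3 > 0 \<and> c4 > 0 \<and> c5 > 0 \<and> c6 > 0 \<and> c7 > 0 \<and> c8 > 0 \<and>
        C_k 3 H \<and> (\<forall>F. 0 \<le> H F) \<and> strictly_convex H \<and>
        C_k 3 R \<and> (\<forall>\<xi>. 0 \<le> R \<xi>) \<and> strictly_convex R \<and>
        (\<forall>F Z w. G (F, Z, w) = H F + R (F, Z, w)) \<and>
        (\<forall>F z. \<kappa> * norm F powr (p - 2) * (norm z)\<^sup>2 \<le> hessian_form H F z \<and>
               hessian_form H F z \<le> \<kappa>' * norm F powr (p - 2) * (norm z)\<^sup>2) \<and>
        (\<forall>\<xi> z. \<gamma> * (norm z)\<^sup>2 \<le> hessian_form R \<xi> z \<and>
               hessian_form R \<xi> z \<le> \<gamma>' * (norm z)\<^sup>2) \<and>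
        (\<forall>F Z w. c1 * norm F powr p + c2 * (norm Z)\<^sup>2 + c3 * \<bar>w\<bar>\<^sup>2 - c4 \<le> G (F, Z, w)) \<and>
        (\<forall>F Z w. G (F, Z, w) \<le> c5 * (norm F powr p + (norm Z)\<^sup>2 + \<bar>w\<bar>\<^sup>2 + 1)) \<and>
        (\<forall>F Z w. case grad G (F, Z, w) of (GF, GZ, Gw) \<Rightarrow>
             norm GF powr (p / (p - 1)) + norm GZ powr (p / (p - 2)) + \<bar>Gw\<bar> powr (p / (p - 3))
               \<le> c6 * (norm F powr p + (norm Z)\<^sup>2 + \<bar>w\<bar>\<^sup>2 + 1)) \<and>
        (\<forall>F. \<forall>a\<in>Basis. \<forall>b\<in>Basis. \<forall>d\<in>Basis.
             \<bar>dir_deriv a (dir_deriv b (dir_deriv d H)) F\<bar> \<le> c7 * norm F powr (p - 3)) \<and>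
        (\<forall>\<xi>. \<forall>a\<in>Basis. \<forall>b\<in>Basis. \<forall>d\<in>Basis.
             \<bar>dir_deriv a (dir_deriv b (dir_deriv d R)) \<xi>\<bar> \<le> c8))"


section \<open>Fields on the torus\<close>

text \<open>The torus is the quotient of \<open>real^3\<close> by the integer lattice; fields on it are
  represented by periodic fields on \<open>real^3\<close>.  Elements of \<open>L\<^sup>2\<close> are represented by functions,
  equality being equality almost everywhere.\<close>

definition int_lattice :: "vec3 set" where
  "int_lattice = {z. \<forall>i. z $ i \<in> \<int>}"

definition unit_cell :: "vec3 set" where
  "unit_cell = {x. \<forall>i. 0 \<le> x $ i \<and> x $ i \<le> 1}"

definition periodic :: "(vec3 \<Rightarrow> 'b) \<Rightarrow> bool" where
  "periodic f \<longleftrightarrow> (\<forall>x. \<forall>z\<in>int_lattice. f (x + z) = f x)"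

definition L2_torus :: "(vec3 \<Rightarrow> 'b::euclidean_space) set" where
  "L2_torus = {f. periodic f \<and> f \<in> borel_measurable lebesgue \<and>
                  set_integrable lebesgue unit_cell (\<lambda>x. (norm (f x))\<^sup>2)}"

definition L2_inner :: "(vec3 \<Rightarrow> 'b::euclidean_space) \<Rightarrow> (vec3 \<Rightarrow> 'b) \<Rightarrow> real" where
  "L2_inner f g = (LINT x:unit_cell|lebesgue. f x \<bullet> g x)"

definition L2_eq :: "(vec3 \<Rightarrow> 'b::euclidean_space) \<Rightarrow> (vec3 \<Rightarrow> 'b) \<Rightarrow> bool" where
  "L2_eq f g \<longleftrightarrow> f \<in> L2_torus \<and> g \<in> L2_torus \<and> (AE x in lebesgue. f x = g x)"

definition locally_integrable :: "(vec3 \<Rightarrow> 'b::euclidean_space) \<Rightarrow> bool" where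
  "locally_integrable f \<longleftrightarrow> (\<forall>C. compact C \<longrightarrow> set_integrable lebesgue C f)"

definition test_function :: "(vec3 \<Rightarrow> real) \<Rightarrow> bool" where
  "test_function \<phi> \<longleftrightarrow> (\<forall>n. C_k n \<phi>) \<and> (\<exists>C. compact C \<and> (\<forall>x. x \<notin> C \<longrightarrow> \<phi> x = 0))"

definition has_weak_gradient :: "(vec3 \<Rightarrow> vec3) \<Rightarrow> (vec3 \<Rightarrow> mat3) \<Rightarrow> bool" where
  "has_weak_gradient y F \<longleftrightarrow>
     locally_integrable y \<and> locally_integrable F \<and>
     (\<forall>\<phi> i \<alpha>. test_function \<phi> \<longrightarrow>
        (LINT x|lebesgue. F x $ i $ \<alpha> * \<phi> x) =
        - (LINT x|lebesgue. y x $ i * dir_deriv (axis \<alpha> 1) \<phi> x))"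

text \<open>The potential \<open>y\<close> lives on \<open>real^3\<close> and need not be periodic.\<close>

definition is_gradient :: "(vec3 \<Rightarrow> mat3) \<Rightarrow> bool" where
  "is_gradient F \<longleftrightarrow> (\<exists>y. has_weak_gradient y F)"


section \<open>Finite element spaces\<close>

text \<open>A finite conforming simplicial triangulation of the torus, given by all the lifts of its
  elements to \<open>real^3\<close>: a lattice-invariant face-to-face tiling by tetrahedra, finitely many
  up to lattice translations.\<close>

definition torus_triangulation :: "vec3 set set \<Rightarrow> bool" where
  "torus_triangulation \<T> \<longleftrightarrow>
     (\<forall>K\<in>\<T>. 3 simplex K) \<and>
     \<Union>\<T> = UNIV \<and>
     (\<forall>K\<in>\<T>. \<forall>K'\<in>\<T>. (K \<inter> K') face_of K) \<and>
     (\<forall>K\<in>\<T>. \<forall>z\<in>int_lattice. (\<lambda>x. x + z) ` K \<in> \<T>) \<and>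
     (\<exists>\<T>0. finite \<T>0 \<and> \<T>0 \<subseteq> \<T> \<and> (\<forall>K\<in>\<T>. \<exists>K0\<in>\<T>0. \<exists>z\<in>int_lattice. K = (\<lambda>x. x + z) ` K0))"

definition poly_fun :: "nat \<Rightarrow> (vec3 \<Rightarrow> real) \<Rightarrow> bool" where
  "poly_fun m f \<longleftrightarrow>
     (\<exists>c :: (3 \<Rightarrow> nat) \<Rightarrow> real. \<forall>x.
        f x = (\<Sum>\<nu> | (\<Sum>i\<in>UNIV. \<nu> i) \<le> m. c \<nu> * (\<Prod>i\<in>UNIV. (x $ i) ^ \<nu> i)))"

definition vpoly :: "nat \<Rightarrow> (vec3 \<Rightarrow> 'b::euclidean_space) \<Rightarrow> bool" where
  "vpoly m f \<longleftrightarrow> (\<forall>b\<in>Basis. poly_fun m (\<lambda>x. f x \<bullet> b))"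

definition U_h :: "vec3 set set \<Rightarrow> nat \<Rightarrow> (vec3 \<Rightarrow> vec3) set" where
  "U_h \<T> k = {\<phi>. continuous_on UNIV \<phi> \<and> periodic \<phi> \<and>
                 (\<forall>K\<in>\<T>. \<exists>q. vpoly k q \<and> (\<forall>x\<in>K. \<phi> x = q x))}"

definition L2_piecewise_poly :: "vec3 set set \<Rightarrow> nat \<Rightarrow> (vec3 \<Rightarrow> 'b::euclidean_space) set" where
  "L2_piecewise_poly \<T> m = {f \<in> L2_torus.
     \<forall>K\<in>\<T>. \<exists>q. vpoly m q \<and> (AE x in lebesgue. x \<in> K \<longrightarrow> f x = q x)}"

definition HF_h :: "vec3 set set \<Rightarrow> nat \<Rightarrow> (vec3 \<Rightarrow> mat3) set" where
  "HF_h \<T> k = L2_piecewise_poly \<T> (k - 1)"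

definition HZ_h :: "vec3 set set \<Rightarrow> nat \<Rightarrow> (vec3 \<Rightarrow> mat3) set" where
  "HZ_h \<T> k = L2_piecewise_poly \<T> (2 * (k - 1))"

definition Hw_h :: "vec3 set set \<Rightarrow> nat \<Rightarrow> (vec3 \<Rightarrow> real) set" where
  "Hw_h \<T> k = L2_piecewise_poly \<T> (3 * (k - 1))"

definition H_h :: "vec3 set set \<Rightarrow> nat \<Rightarrow> (vec3 \<Rightarrow> state) set" where
  "H_h \<T> k = {\<lambda>x. (A x, B x, d x) | A B d. A \<in> HF_h \<T> k \<and> B \<in> HZ_h \<T> k \<and> d \<in> Hw_h \<T> k}"

text \<open>The elementwise gradient of a function in \<open>U_h\<close>: in the interior of each element it is
  the classical one, \<open>nabla v x $ i $ \<alpha>\<close> being the partial derivative of \<open>v $ i\<close> in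
  direction \<open>\<alpha>\<close>.  Its values at points of element boundaries where \<open>v\<close> is not differentiable
  are unspecified; these points form a null set.\<close>

definition nabla :: "(vec3 \<Rightarrow> vec3) \<Rightarrow> vec3 \<Rightarrow> mat3" where
  "nabla v x = jacobian v (at x)"


section \<open>The fully discrete scheme\<close>

definition solves_scheme ::
  "(state \<Rightarrow> real) \<Rightarrow> vec3 set set \<Rightarrow> nat \<Rightarrow> real \<Rightarrow>
   (vec3 \<Rightarrow> vec3) \<Rightarrow> (vec3 \<Rightarrow> state) \<Rightarrow> (vec3 \<Rightarrow> vec3) \<Rightarrow> (vec3 \<Rightarrow> state) \<Rightarrow> bool" where
  "solves_scheme G \<T> k \<tau> v0 \<xi>0 v1 \<xi>1 \<longleftrightarrow>
     (\<forall>\<phi>\<in>U_h \<T> k.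
        L2_inner (\<lambda>x. (1 / \<tau>) *\<^sub>R (v1 x - v0 x)) \<phi> =
        - L2_inner (\<lambda>x. grad G (\<xi>1 x)) (\<lambda>x. DPhi (fst (\<xi>0 x)) (nabla \<phi> x))) \<and>
     (\<forall>\<psi>\<in>H_h \<T> k.
        L2_inner (\<lambda>x. (1 / \<tau>) *\<^sub>R (\<xi>1 x - \<xi>0 x)) \<psi> =
        L2_inner (\<lambda>x. DPhi (fst (\<xi>0 x)) (nabla v1 x)) \<psi>)"

end

theory Submission
  imports Defs
begin

text \<open>The derivatives of the minors are polynomials in the matrix entries, so that
  \<open>DPhi F0 (nabla v1)\<close> has the piecewise degrees \<open>k - 1\<close>, \<open>2 * (k - 1)\<close> and \<open>3 * (k - 1)\<close> of the
  three slots of \<open>H_h\<close>.  The residual of the second equation is therefore itself an admissible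
  test function, and testing with it shows that its \<open>L\<^sup>2\<close> norm vanishes.  A potential of
  \<open>F1\<close> is then \<open>y + \<tau> *\<^sub>R v1\<close> for a potential \<open>y\<close> of \<open>F0\<close>, once the elementwise gradient of
  \<open>v1\<close> is known to be its weak gradient.  This holds because \<open>v1\<close> is locally Lipschitz and
  differentiable almost everywhere: translation invariance moves difference quotients from \<open>v1\<close>
  to the test function, and both sides converge by dominated convergence, so that no integration
  by parts over the elements is needed.\<close>

section \<open>Polynomials\<close>

text \<open>The difficulty lies in the representation of fields. Members of \<open>H_h\<close> are
  functions, periodic at every point, but polynomial on the closed elements only almost everywhere;
  members of \<open>U_h\<close> agree with polynomials at every point of each closed element. To
  place the residual in \<open>H_h\<close>, periodicity must cover even the unspecified values of
  \<open>nabla v1\<close> on faces, while the degree bounds rest on faces being null.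
  \<open>L2_inner\<close> integrates over one unit cell, whereas \<open>L2_eq\<close> speaks of
  almost every point of \<open>real^3\<close>; countably many lattice translations bridge the gap.
  The degrees fit because the derivative of a minor of order m is linear in the direction and
  homogeneous of degree m - 1 in the matrix, hence a sum of products of m entries, each of degree at
  most \<open>k - 1\<close>. Agreement on closed elements joins the elementwise Lipschitz bounds
  across faces; this excludes face contributions to the weak gradient. Local finiteness keeps all
  constants finite on bounded sets.\<close>

text \<open>Sums over infinite sets are 0 by convention, so \<open>poly_fun\<close> describes
  polynomials only thanks to this. Each exponent is at most the total degree, which leaves finitely
  many choices.\<close>

lemma finite_multiindices: "finite {\<nu> :: 3 \<Rightarrow> nat. (\<Sum>i\<in>UNIV. \<nu> i) \<le> m}"
proof (rule finite_subset)
  show "{\<nu> :: 3 \<Rightarrow> nat. (\<Sum>i\<in>UNIV. \<nu> i) \<le> m} \<subseteq> (UNIV \<rightarrow>\<^sub>E {..m})"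
  proof
    fix \<nu> :: "3 \<Rightarrow> nat" assume "\<nu> \<in> {\<nu>. (\<Sum>i\<in>UNIV. \<nu> i) \<le> m}"
    moreover have "\<nu> j \<le> (\<Sum>i\<in>UNIV. \<nu> i)" for j
      by (rule member_le_sum) auto
    ultimately show "\<nu> \<in> UNIV \<rightarrow>\<^sub>E {..m}"
      using order_trans by auto
  qed
  show "finite (UNIV \<rightarrow>\<^sub>E {..m} :: (3 \<Rightarrow> nat) set)"
    by (rule finite_PiE) auto
qed

text \<open>Admits monomials with computed exponents, so that neither the convolution of
  coefficients in a product nor the reindexing in a derivative has to be carried out.\<close>

lemma poly_fun_monomial:
  assumes "(\<Sum>i\<in>UNIV. \<nu> i) \<le> m"
  shows "poly_fun m (\<lambda>x. a * (\<Prod>i\<in>UNIV. x $ i ^ \<nu> i))"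
proof -
  have "a * (\<Prod>i\<in>UNIV. x $ i ^ \<nu> i)
      = (\<Sum>\<mu> | (\<Sum>i\<in>UNIV. \<mu> i) \<le> m. (if \<mu> = \<nu> then a else 0) * (\<Prod>i\<in>UNIV. x $ i ^ \<mu> i))" for x :: vec3
  proof -
    have "(\<Sum>\<mu> | (\<Sum>i\<in>UNIV. \<mu> i) \<le> m. (if \<mu> = \<nu> then a else 0) * (\<Prod>i\<in>UNIV. x $ i ^ \<mu> i))
        = (\<Sum>\<mu>\<in>{\<nu>}. (if \<mu> = \<nu> then a else 0) * (\<Prod>i\<in>UNIV. x $ i ^ \<mu> i))"
      using assms by (intro sum.mono_neutral_right) (auto simp: finite_multiindices)
    then show ?thesis by simp
  qed
  then show ?thesis
    unfolding poly_fun_def by (intro exI[of _ "\<lambda>\<mu>. if \<mu> = \<nu> then a else 0"] allI)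
qed

lemma poly_fun_const: "poly_fun m (\<lambda>x. a)"
  using poly_fun_monomial[of "\<lambda>_. 0" m a] by simp

lemma poly_fun_add:
  assumes "poly_fun m f" "poly_fun m g"
  shows "poly_fun m (\<lambda>x. f x + g x)"
proof -
  obtain c d where "\<And>x. f x = (\<Sum>\<nu> | (\<Sum>i\<in>UNIV. \<nu> i) \<le> m. c \<nu> * (\<Prod>i\<in>UNIV. x $ i ^ \<nu> i))"
    and "\<And>x. g x = (\<Sum>\<nu> | (\<Sum>i\<in>UNIV. \<nu> i) \<le> m. d \<nu> * (\<Prod>i\<in>UNIV. x $ i ^ \<nu> i))"
    using assms unfolding poly_fun_def by blast
  then show ?thesis
    unfolding poly_fun_def
    by (intro exI[of _ "\<lambda>\<nu>. c \<nu> + d \<nu>"]) (simp add: distrib_right sum.distrib)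
qed

lemma poly_fun_sum:
  assumes "\<And>i. i \<in> I \<Longrightarrow> poly_fun m (f i)"
  shows "poly_fun m (\<lambda>x. \<Sum>i\<in>I. f i x)"
  using assms by (induction I rule: infinite_finite_induct) (auto intro: poly_fun_const poly_fun_add)

lemma poly_fun_mult:
  assumes "poly_fun m f" "poly_fun n g"
  shows "poly_fun (m + n) (\<lambda>x. f x * g x)"
proof -
  obtain c d where c: "\<And>x. f x = (\<Sum>\<nu> | (\<Sum>i\<in>UNIV. \<nu> i) \<le> m. c \<nu> * (\<Prod>i\<in>UNIV. x $ i ^ \<nu> i))"
    and d: "\<And>x. g x = (\<Sum>\<nu> | (\<Sum>i\<in>UNIV. \<nu> i) \<le> n. d \<nu> * (\<Prod>i\<in>UNIV. x $ i ^ \<nu> i))"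
    using assms unfolding poly_fun_def by blast
  have "f x * g x = (\<Sum>\<nu> | (\<Sum>i\<in>UNIV. \<nu> i) \<le> m. \<Sum>\<mu> | (\<Sum>i\<in>UNIV. \<mu> i) \<le> n.
      (c \<nu> * d \<mu>) * (\<Prod>i\<in>UNIV. x $ i ^ (\<nu> i + \<mu> i)))" for x
    by (simp add: c d sum_product power_add prod.distrib mult_ac)
  moreover have "poly_fun (m + n) (\<lambda>x. \<Sum>\<nu> | (\<Sum>i\<in>UNIV. \<nu> i) \<le> m. \<Sum>\<mu> | (\<Sum>i\<in>UNIV. \<mu> i) \<le> n.
      (c \<nu> * d \<mu>) * (\<Prod>i\<in>UNIV. x $ i ^ (\<nu> i + \<mu> i)))"
    by (intro poly_fun_sum poly_fun_monomial) (auto simp: sum.distrib intro: add_mono)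
  ultimately show ?thesis by simp
qed

text \<open>The exponent \<open>\<nu> \<alpha> - 1\<close> is a truncated subtraction; for
  \<open>\<nu> \<alpha> = 0\<close> the factor \<open>real (\<nu> \<alpha>)\<close> makes the term
  vanish.\<close>

lemma monomial_has_derivative:
  "((\<lambda>x. \<Prod>i\<in>UNIV. x $ i ^ \<nu> i) has_derivative
     (\<lambda>h. \<Sum>\<alpha>\<in>UNIV. (real (\<nu> \<alpha>) * (\<Prod>i\<in>UNIV. x $ i ^ (\<nu>(\<alpha> := \<nu> \<alpha> - 1)) i)) * h $ \<alpha>)) (at (x :: vec3))"
proof -
  have eq: "(\<Prod>i\<in>UNIV. x $ i ^ (\<nu>(\<alpha> := \<nu> \<alpha> - 1)) i)
      = x $ \<alpha> ^ (\<nu> \<alpha> - 1) * (\<Prod>j\<in>UNIV - {\<alpha>}. x $ j ^ \<nu> j)" for \<alpha>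
  proof -
    have "(\<Prod>i\<in>UNIV. x $ i ^ (\<nu>(\<alpha> := \<nu> \<alpha> - 1)) i)
        = x $ \<alpha> ^ (\<nu> \<alpha> - 1) * (\<Prod>j\<in>UNIV - {\<alpha>}. x $ j ^ (\<nu>(\<alpha> := \<nu> \<alpha> - 1)) j)"
      by (subst prod.remove[of _ \<alpha>]) auto
    also have "(\<Prod>j\<in>UNIV - {\<alpha>}. x $ j ^ (\<nu>(\<alpha> := \<nu> \<alpha> - 1)) j) = (\<Prod>j\<in>UNIV - {\<alpha>}. x $ j ^ \<nu> j)"
      by (rule prod.cong) auto
    finally show ?thesis .
  qed
  have "((\<lambda>x. x $ \<alpha> ^ \<nu> \<alpha>) has_derivative (\<lambda>h. real (\<nu> \<alpha>) * h $ \<alpha> * x $ \<alpha> ^ (\<nu> \<alpha> - 1))) (at x)" for \<alpha>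
    using has_derivative_power[OF bounded_linear_imp_has_derivative[OF bounded_linear_vec_nth],
        where x = x and S = UNIV and n = "\<nu> \<alpha>"] by (simp add: mult_ac)
  then have "((\<lambda>x. \<Prod>i\<in>UNIV. x $ i ^ \<nu> i) has_derivative
     (\<lambda>h. \<Sum>\<alpha>\<in>UNIV. (real (\<nu> \<alpha>) * h $ \<alpha> * x $ \<alpha> ^ (\<nu> \<alpha> - 1)) * (\<Prod>j\<in>UNIV - {\<alpha>}. x $ j ^ \<nu> j))) (at x)"
    by (intro has_derivative_prod)
  also have "(\<lambda>h. \<Sum>\<alpha>\<in>UNIV. (real (\<nu> \<alpha>) * h $ \<alpha> * x $ \<alpha> ^ (\<nu> \<alpha> - 1)) * (\<Prod>j\<in>UNIV - {\<alpha>}. x $ j ^ \<nu> j))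
    = (\<lambda>h. \<Sum>\<alpha>\<in>UNIV. (real (\<nu> \<alpha>) * (\<Prod>i\<in>UNIV. x $ i ^ (\<nu>(\<alpha> := \<nu> \<alpha> - 1)) i)) * h $ \<alpha>)"
    by (intro ext sum.cong refl) (simp only: eq mult_ac)
  finally show ?thesis .
qed

lemma poly_fun_has_derivative:
  assumes "poly_fun m f"
  obtains p where "\<And>\<alpha>. poly_fun (m - 1) (p \<alpha>)"
    and "\<And>x. (f has_derivative (\<lambda>h. \<Sum>\<alpha>\<in>UNIV. p \<alpha> x * h $ \<alpha>)) (at x)"
proof -
  obtain c where c: "f = (\<lambda>x. \<Sum>\<nu> | (\<Sum>i\<in>UNIV. \<nu> i) \<le> m. c \<nu> * (\<Prod>i\<in>UNIV. x $ i ^ \<nu> i))"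
    using assms unfolding poly_fun_def by blast
  define p where "p = (\<lambda>\<alpha> x. \<Sum>\<nu> | (\<Sum>i\<in>UNIV. \<nu> i) \<le> m.
     c \<nu> * real (\<nu> \<alpha>) * (\<Prod>i\<in>UNIV. x $ i ^ (\<nu>(\<alpha> := \<nu> \<alpha> - 1)) i))" for x :: vec3
  show thesis
  proof (rule that[of p])
    fix \<alpha>
    show "poly_fun (m - 1) (p \<alpha>)"
      unfolding p_def
    proof (rule poly_fun_sum)
      fix \<nu> :: "3 \<Rightarrow> nat" assume "\<nu> \<in> {\<nu>. (\<Sum>i\<in>UNIV. \<nu> i) \<le> m}"
      then have le: "(\<Sum>i\<in>UNIV. \<nu> i) \<le> m" by simp
      show "poly_fun (m - 1) (\<lambda>x. c \<nu> * real (\<nu> \<alpha>) * (\<Prod>i\<in>UNIV. x $ i ^ (\<nu>(\<alpha> := \<nu> \<alpha> - 1)) i))"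
      \<comment> \<open>At exponent 0 the truncated subtraction lowers nothing and the degree bound
        \<open>m - 1\<close> could fail, but the coefficient is 0.\<close>
      proof (cases "\<nu> \<alpha> = 0")
        case True
        then show ?thesis by (simp add: poly_fun_const)
      next
        case False
        have "(\<Sum>i\<in>UNIV. (\<nu>(\<alpha> := \<nu> \<alpha> - 1)) i) = (\<nu> \<alpha> - 1) + (\<Sum>i\<in>UNIV - {\<alpha>}. (\<nu>(\<alpha> := \<nu> \<alpha> - 1)) i)"
          by (subst sum.remove[of _ \<alpha>]) auto
        also have "(\<Sum>i\<in>UNIV - {\<alpha>}. (\<nu>(\<alpha> := \<nu> \<alpha> - 1)) i) = (\<Sum>i\<in>UNIV - {\<alpha>}. \<nu> i)"
          by (rule sum.cong) auto
        finally have "(\<Sum>i\<in>UNIV. (\<nu>(\<alpha> := \<nu> \<alpha> - 1)) i) = (\<nu> \<alpha> - 1) + (\<Sum>i\<in>UNIV - {\<alpha>}. \<nu> i)" .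
        moreover have "(\<Sum>i\<in>UNIV. \<nu> i) = \<nu> \<alpha> + (\<Sum>i\<in>UNIV - {\<alpha>}. \<nu> i)"
          by (subst sum.remove[of _ \<alpha>]) auto
        ultimately show ?thesis
          using le False by (intro poly_fun_monomial) linarith
      qed
    qed
  next
    fix x
    have "(f has_derivative (\<lambda>h. \<Sum>\<nu> | (\<Sum>i\<in>UNIV. \<nu> i) \<le> m. c \<nu> *
       (\<Sum>\<alpha>\<in>UNIV. (real (\<nu> \<alpha>) * (\<Prod>i\<in>UNIV. x $ i ^ (\<nu>(\<alpha> := \<nu> \<alpha> - 1)) i)) * h $ \<alpha>))) (at x)"
      unfolding c by (intro has_derivative_sum has_derivative_mult_right monomial_has_derivative)
    also have "(\<lambda>h. \<Sum>\<nu> | (\<Sum>i\<in>UNIV. \<nu> i) \<le> m. c \<nu> *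
       (\<Sum>\<alpha>\<in>UNIV. (real (\<nu> \<alpha>) * (\<Prod>i\<in>UNIV. x $ i ^ (\<nu>(\<alpha> := \<nu> \<alpha> - 1)) i)) * h $ \<alpha>))
       = (\<lambda>h. \<Sum>\<alpha>\<in>UNIV. p \<alpha> x * h $ \<alpha>)"
      unfolding p_def sum_distrib_left sum_distrib_right
      by (subst sum.swap) (simp only: mult.assoc)
    finally show "(f has_derivative (\<lambda>h. \<Sum>\<alpha>\<in>UNIV. p \<alpha> x * h $ \<alpha>)) (at x)" .
  qed
qed

lemma poly_fun_continuous:
  assumes "poly_fun m f" shows "continuous_on S f"
proof -
  obtain p where "\<And>x. (f has_derivative (\<lambda>h. \<Sum>\<alpha>\<in>UNIV. p \<alpha> x * h $ \<alpha>)) (at x)"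
    using poly_fun_has_derivative[OF assms] by metis
  then show ?thesis
    by (meson has_derivative_continuous continuous_at_imp_continuous_on)
qed

text \<open>Mean value inequality on the convex set \<open>K\<close>: the partial derivatives are
  bounded on the compact \<open>K\<close>, and the sum of their bounds controls the operator norm
  because \<open>\<bar>h $ \<alpha>\<bar> \<le> norm h\<close>.\<close>

lemma poly_fun_lipschitz:
  assumes f: "poly_fun m f" and K: "compact K" "convex K"
  obtains L where "\<And>x y. x \<in> K \<Longrightarrow> y \<in> K \<Longrightarrow> \<bar>f x - f y\<bar> \<le> L * norm (x - y)"
proof -
  obtain p where p: "\<And>\<alpha>. poly_fun (m - 1) (p \<alpha>)"
    and der: "\<And>x. (f has_derivative (\<lambda>h. \<Sum>\<alpha>\<in>UNIV. p \<alpha> x * h $ \<alpha>)) (at x)"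
    by (metis poly_fun_has_derivative[OF f])
  have "bounded (p \<alpha> ` K)" for \<alpha>
    by (rule compact_imp_bounded[OF compact_continuous_image[OF poly_fun_continuous[OF p] K(1)]])
  then have "\<forall>\<alpha>. \<exists>B. \<forall>x\<in>K. \<bar>p \<alpha> x\<bar> \<le> B"
    unfolding bounded_iff by auto
  then obtain B where B: "\<And>\<alpha> x. x \<in> K \<Longrightarrow> \<bar>p \<alpha> x\<bar> \<le> B \<alpha>"
    by metis
  show thesis
  proof (rule that)
    fix x y assume xy: "x \<in> K" "y \<in> K"
    have "norm (f x - f y) \<le> (\<Sum>\<alpha>\<in>UNIV. B \<alpha>) * norm (x - y)"
    proof (rule differentiable_bound[OF K(2) has_derivative_at_withinI[OF der] _ xy])
      fix z assume z: "z \<in> K"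
      show "onorm (\<lambda>h. \<Sum>\<alpha>\<in>UNIV. p \<alpha> z * h $ \<alpha>) \<le> (\<Sum>\<alpha>\<in>UNIV. B \<alpha>)"
      proof (rule onorm_le)
        fix h :: vec3
        have "norm (\<Sum>\<alpha>\<in>UNIV. p \<alpha> z * h $ \<alpha>) \<le> (\<Sum>\<alpha>\<in>UNIV. \<bar>p \<alpha> z\<bar> * \<bar>h $ \<alpha>\<bar>)"
          by (rule order_trans[OF norm_sum]) (simp add: abs_mult)
        also have "\<dots> \<le> (\<Sum>\<alpha>\<in>UNIV. B \<alpha> * norm h)"
        proof (rule sum_mono)
          fix \<alpha> :: 3
          show "\<bar>p \<alpha> z\<bar> * \<bar>h $ \<alpha>\<bar> \<le> B \<alpha> * norm h"
            using B[OF z, of \<alpha>] by (intro mult_mono component_le_norm_cart) auto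
        qed
        finally show "norm (\<Sum>\<alpha>\<in>UNIV. p \<alpha> z * h $ \<alpha>) \<le> (\<Sum>\<alpha>\<in>UNIV. B \<alpha>) * norm h"
          by (simp add: sum_distrib_right)
      qed
    qed
    then show "\<bar>f x - f y\<bar> \<le> (\<Sum>\<alpha>\<in>UNIV. B \<alpha>) * norm (x - y)" by simp
  qed
qed

section \<open>Triangulations of the torus\<close>

lemma finite_int_lattice_bounded: "finite {z \<in> int_lattice. norm z \<le> r}"
proof (rule finite_subset)
  show "{z \<in> int_lattice. norm z \<le> r} \<subseteq>
      (\<lambda>f. \<chi> i. of_int (f i)) ` (UNIV \<rightarrow>\<^sub>E {-\<lceil>r\<rceil>..\<lceil>r\<rceil>})"
  proof
    fix z assume "z \<in> {z \<in> int_lattice. norm z \<le> r}"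
    then have z: "\<And>i. z $ i \<in> \<int>" "norm z \<le> r"
      by (auto simp: int_lattice_def)
    have "z = (\<chi> i. of_int \<lfloor>z $ i\<rfloor>)"
      proof (simp add: vec_eq_iff, rule allI)
      fix i
      show "z $ i = of_int \<lfloor>z $ i\<rfloor>" using z(1)[of i] by (metis Ints_cases floor_of_int)
    qed
    moreover have "\<lfloor>z $ i\<rfloor> \<in> {-\<lceil>r\<rceil>..\<lceil>r\<rceil>}" for i
    proof -
      have "\<bar>z $ i\<bar> \<le> r" using component_le_norm_cart z(2) order_trans by blast
      then show ?thesis unfolding atLeastAtMost_iff by linarith
    qed
    ultimately show "z \<in> (\<lambda>f. \<chi> i. of_int (f i)) ` (UNIV \<rightarrow>\<^sub>E {-\<lceil>r\<rceil>..\<lceil>r\<rceil>})"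
      by (intro image_eqI[of _ _ "\<lambda>i. \<lfloor>z $ i\<rfloor>"]) auto
  qed
  show "finite ((\<lambda>f. \<chi> i. of_int (f i)) ` (UNIV \<rightarrow>\<^sub>E {-\<lceil>r\<rceil>..\<lceil>r\<rceil>}) :: vec3 set)"
    by (intro finite_imageI finite_PiE) auto
qed

lemma countable_int_lattice: "countable int_lattice"
proof -
  have "int_lattice = (\<Union>n. {z \<in> int_lattice. norm z \<le> real n})"
    by (auto intro: real_arch_simple)
  moreover have "countable (\<Union>n. {z \<in> int_lattice. norm z \<le> real n})"
    by (rule countable_UN[OF countableI_type countable_finite[OF finite_int_lattice_bounded]])
  ultimately show ?thesis by simp
qed

lemma torus_triangulation_simplex:
  assumes "torus_triangulation \<T>" "K \<in> \<T>"
  shows "3 simplex K"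
proof -
  from assms(1) have "\<forall>K\<in>\<T>. 3 simplex K"
    unfolding torus_triangulation_def by (elim conjE)
  with assms(2) show ?thesis by simp
qed

lemmas torus_triangulation_compact = compact_simplex[OF torus_triangulation_simplex]
  and torus_triangulation_convex = convex_simplex[OF torus_triangulation_simplex]

lemma torus_triangulation_cover: "torus_triangulation \<T> \<Longrightarrow> \<Union>\<T> = UNIV"
  unfolding torus_triangulation_def by (elim conjE)

text \<open>Every element is a lattice translate of one of finitely many bounded elements. If the
  translate by \<open>z\<close> meets \<open>S\<close>, then \<open>norm z\<close> is at most a
  radius of \<open>S\<close> plus a radius of the representatives, and only finitely many lattice
  points satisfy this.\<close>

lemma torus_triangulation_locally_finite:
  assumes T: "torus_triangulation \<T>" and S: "bounded S"
  shows "finite {K \<in> \<T>. K \<inter> S \<noteq> {}}"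
proof -
  from T have "\<exists>\<T>0. finite \<T>0 \<and> \<T>0 \<subseteq> \<T> \<and>
      (\<forall>K\<in>\<T>. \<exists>K0\<in>\<T>0. \<exists>z\<in>int_lattice. K = (\<lambda>x. x + z) ` K0)"
    unfolding torus_triangulation_def by (elim conjE)
  then obtain \<T>0 where T0: "finite \<T>0" "\<T>0 \<subseteq> \<T>"
    and T0_cover: "\<forall>K\<in>\<T>. \<exists>K0\<in>\<T>0. \<exists>z\<in>int_lattice. K = (\<lambda>x. x + z) ` K0"
    by (elim exE conjE)
  have "bounded (\<Union>\<T>0)"
  proof (rule bounded_Union[OF T0(1)])
    show "\<forall>K\<in>\<T>0. bounded K"
    proof
      fix K assume "K \<in> \<T>0"
      then have "K \<in> \<T>" using T0(2) by (rule rev_subsetD)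
      then show "bounded K"
        by (rule compact_imp_bounded[OF torus_triangulation_compact[OF T]])
    qed
  qed
  then obtain B where B: "\<And>x. x \<in> \<Union>\<T>0 \<Longrightarrow> norm x \<le> B"
    unfolding bounded_iff by blast
  obtain R where R: "\<And>x. x \<in> S \<Longrightarrow> norm x \<le> R"
    using S unfolding bounded_iff by blast
  have "{K \<in> \<T>. K \<inter> S \<noteq> {}} \<subseteq>
      (\<lambda>(K0, z). (\<lambda>x. x + z) ` K0) ` (\<T>0 \<times> {z \<in> int_lattice. norm z \<le> R + B})"
  proof
    fix K assume "K \<in> {K \<in> \<T>. K \<inter> S \<noteq> {}}"
    then have "K \<in> \<T>" and KS: "K \<inter> S \<noteq> {}" by auto
    with T0_cover obtain K0 z where K0: "K0 \<in> \<T>0" "z \<in> int_lattice" "K = (\<lambda>x. x + z) ` K0"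
      by metis
    with KS obtain y where K: "y \<in> K0" "y + z \<in> S" by blast
    have "norm z \<le> norm (y + z) + norm y"
      by (metis add_diff_cancel_left' norm_triangle_ineq4)
    also have "\<dots> \<le> R + B"
      using R[OF K(2)] B[OF UnionI[OF K0(1) K(1)]] by simp
    finally show "K \<in> (\<lambda>(K0, z). (\<lambda>x. x + z) ` K0) ` (\<T>0 \<times> {z \<in> int_lattice. norm z \<le> R + B})"
      using K0 by (intro image_eqI[of _ _ "(K0, z)"]) auto
  qed
  moreover have "finite ((\<lambda>(K0, z). (\<lambda>x. x + z) ` K0) ` (\<T>0 \<times> {z \<in> int_lattice. norm z \<le> R + B}))"
    using T0(1) finite_int_lattice_bounded by simp
  ultimately show ?thesis
    by (rule finite_subset)
qed

lemma torus_triangulation_countable: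
  assumes T: "torus_triangulation \<T>"
  shows "countable \<T>"
proof -
  \<comment> \<open>The empty set meets no ball, so it is inserted separately.\<close>
  have "\<T> \<subseteq> insert {} (\<Union>n. {K \<in> \<T>. K \<inter> cball 0 (real n) \<noteq> {}})"
  proof
    fix K assume K: "K \<in> \<T>"
    show "K \<in> insert {} (\<Union>n. {K \<in> \<T>. K \<inter> cball 0 (real n) \<noteq> {}})"
    proof (cases "K = {}")
      case False
      then obtain x where "x \<in> K" by auto
      moreover obtain n where "norm x \<le> real n" using real_arch_simple by blast
      ultimately have "K \<inter> cball 0 (real n) \<noteq> {}" by auto
      then show ?thesis using K by blast
    qed simp
  qed
  moreover have "countable (\<Union>n. {K \<in> \<T>. K \<inter> cball 0 (real n) \<noteq> {}})"
    by (rule countable_UN[OF countableI_type countable_finite[OF torus_triangulation_locally_finite[OF T bounded_cball]]])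
  ultimately show ?thesis
    by (meson countable_insert countable_subset)
qed

section \<open>Piecewise polynomials\<close>

text \<open>The scalar core of \<open>L2_piecewise_poly\<close>, with periodicity and square
  integrability split off so that sums and products can be treated entry by entry. Agreement is
  almost everywhere, as befits representatives of \<open>L\<^sup>2\<close> fields.\<close>

definition pw_poly :: "vec3 set set \<Rightarrow> nat \<Rightarrow> (vec3 \<Rightarrow> real) \<Rightarrow> bool" where
  "pw_poly \<T> m f \<longleftrightarrow>
     (\<forall>K\<in>\<T>. \<exists>q. poly_fun m q \<and> (AE x in lebesgue. x \<in> K \<longrightarrow> f x = q x))"

lemma pw_polyE:
  assumes "pw_poly \<T> m f" "K \<in> \<T>"
  obtains q where "poly_fun m q" "AE x in lebesgue. x \<in> K \<longrightarrow> f x = q x"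
  using assms unfolding pw_poly_def by metis

lemma pw_polyI:
  assumes "\<And>K. K \<in> \<T> \<Longrightarrow> \<exists>q. poly_fun m q \<and> (AE x in lebesgue. x \<in> K \<longrightarrow> f x = q x)"
  shows "pw_poly \<T> m f"
  using assms by (simp add: pw_poly_def)

lemma pw_poly_const: "pw_poly \<T> m (\<lambda>x. a)"
  by (rule pw_polyI) (use poly_fun_const in auto)

lemma pw_poly_add:
  assumes "pw_poly \<T> m f" "pw_poly \<T> m g"
  shows "pw_poly \<T> m (\<lambda>x. f x + g x)"
proof (rule pw_polyI)
  fix K assume K: "K \<in> \<T>"
  obtain p where p: "poly_fun m p" "AE x in lebesgue. x \<in> K \<longrightarrow> f x = p x"
    using pw_polyE[OF assms(1) K] .
  obtain q where q: "poly_fun m q" "AE x in lebesgue. x \<in> K \<longrightarrow> g x = q x"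
    using pw_polyE[OF assms(2) K] .
  have "AE x in lebesgue. x \<in> K \<longrightarrow> f x + g x = p x + q x"
    using p(2) q(2) by eventually_elim simp
  with p(1) q(1) show "\<exists>q. poly_fun m q \<and> (AE x in lebesgue. x \<in> K \<longrightarrow> f x + g x = q x)"
    by (intro exI[of _ "\<lambda>x. p x + q x"] conjI poly_fun_add)
qed

lemma pw_poly_mult:
  assumes "pw_poly \<T> m f" "pw_poly \<T> n g"
  shows "pw_poly \<T> (m + n) (\<lambda>x. f x * g x)"
proof (rule pw_polyI)
  fix K assume K: "K \<in> \<T>"
  obtain p where p: "poly_fun m p" "AE x in lebesgue. x \<in> K \<longrightarrow> f x = p x"
    using pw_polyE[OF assms(1) K] .
  obtain q where q: "poly_fun n q" "AE x in lebesgue. x \<in> K \<longrightarrow> g x = q x"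
    using pw_polyE[OF assms(2) K] .
  have "AE x in lebesgue. x \<in> K \<longrightarrow> f x * g x = p x * q x"
    using p(2) q(2) by eventually_elim simp
  with p(1) q(1) show "\<exists>q. poly_fun (m + n) q \<and> (AE x in lebesgue. x \<in> K \<longrightarrow> f x * g x = q x)"
    by (intro exI[of _ "\<lambda>x. p x * q x"] conjI poly_fun_mult)
qed

lemma pw_poly_cmult: "pw_poly \<T> m f \<Longrightarrow> pw_poly \<T> m (\<lambda>x. a * f x)"
  using pw_poly_mult[OF pw_poly_const[of \<T> 0 a]] by simp

lemma pw_poly_diff: "pw_poly \<T> m f \<Longrightarrow> pw_poly \<T> m g \<Longrightarrow> pw_poly \<T> m (\<lambda>x. f x - g x)"
  using pw_poly_add[OF _ pw_poly_cmult[of \<T> m g "-1"]] by simp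

lemma pw_poly_sum:
  assumes "\<And>i. i \<in> I \<Longrightarrow> pw_poly \<T> m (f i)"
  shows "pw_poly \<T> m (\<lambda>x. \<Sum>i\<in>I. f i x)"
  using assms by (induction I rule: infinite_finite_induct) (auto intro: pw_poly_const pw_poly_add)

text \<open>On each element the function agrees almost everywhere with a continuous one;
  completeness of Lebesgue measure transfers measurability, and countably many closed elements cover
  the space.\<close>

lemma pw_poly_measurable:
  assumes T: "torus_triangulation \<T>" and f: "pw_poly \<T> m f"
  shows "f \<in> borel_measurable lebesgue"
proof (rule measurable_piecewise_restrict[OF torus_triangulation_countable[OF T]])
  show "space lebesgue \<subseteq> \<Union>\<T>"
    using torus_triangulation_cover[OF T] by simp
  fix K assume K: "K \<in> \<T>"
  have cl: "closed K"
    using torus_triangulation_compact[OF T K] by (rule compact_imp_closed)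
  then show "K \<inter> space lebesgue \<in> sets lebesgue" by simp
  obtain q where q: "poly_fun m q" "AE x in lebesgue. x \<in> K \<longrightarrow> f x = q x"
    using pw_polyE[OF f K] .
  have "(\<lambda>x. if x \<in> K then q x else 0) \<in> borel_measurable lebesgue"
  proof -
    have "q \<in> borel_measurable borel"
      by (rule borel_measurable_continuous_onI[OF poly_fun_continuous[OF q(1)]])
    then have "q \<in> borel_measurable lebesgue"
      by (intro measurable_completion) simp
    then show ?thesis
      using cl by (intro measurable_If_set) auto
  qed
  then have "(\<lambda>x. if x \<in> K then f x else 0) \<in> borel_measurable lebesgue"
    by (rule borel_measurable_AE) (use q(2) in \<open>auto elim: eventually_mono\<close>)
  then show "f \<in> borel_measurable (restrict_space lebesgue K)"
    using cl by (subst (asm) borel_measurable_if) auto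
qed

text \<open>Only finitely many elements meet \<open>S\<close>, and on each of them the polynomial is
  bounded by compactness. The bound is an essential one, since values on null sets are
  arbitrary.\<close>

lemma pw_poly_bounded:
  assumes T: "torus_triangulation \<T>" and f: "pw_poly \<T> m f" and S: "bounded S"
  shows "\<exists>B. AE x in lebesgue. x \<in> S \<longrightarrow> \<bar>f x\<bar> \<le> B"
proof -
  let ?\<F> = "{K \<in> \<T>. K \<inter> S \<noteq> {}}"
  have fin: "finite ?\<F>" by (rule torus_triangulation_locally_finite[OF T S])
  have "\<exists>B. AE x in lebesgue. x \<in> K \<longrightarrow> \<bar>f x\<bar> \<le> B" if K: "K \<in> \<T>" for K
  proof -
    obtain q where q: "poly_fun m q" "AE x in lebesgue. x \<in> K \<longrightarrow> f x = q x"
      using pw_polyE[OF f K] .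
    have "bounded (q ` K)"
      by (rule compact_imp_bounded[OF compact_continuous_image[OF poly_fun_continuous[OF q(1)]
            torus_triangulation_compact[OF T K]]])
    then obtain B where "\<And>x. x \<in> K \<Longrightarrow> \<bar>q x\<bar> \<le> B"
      unfolding bounded_iff by auto
    then have "AE x in lebesgue. x \<in> K \<longrightarrow> \<bar>f x\<bar> \<le> B"
      using q(2) by (auto elim!: eventually_mono)
    then show ?thesis ..
  qed
  then obtain B where B: "\<And>K. K \<in> \<T> \<Longrightarrow> AE x in lebesgue. x \<in> K \<longrightarrow> \<bar>f x\<bar> \<le> B K"
    by metis
  have "AE x in lebesgue. \<forall>K\<in>?\<F>. x \<in> K \<longrightarrow> \<bar>f x\<bar> \<le> B K"
    by (rule AE_finite_allI[OF fin]) (use B in auto)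
  \<comment> \<open>The sum of absolute values dominates every \<open>B K\<close> and, unlike a
    maximum, makes sense for an empty family.\<close>
  then have "AE x in lebesgue. x \<in> S \<longrightarrow> \<bar>f x\<bar> \<le> (\<Sum>K\<in>?\<F>. \<bar>B K\<bar>)"
  proof (rule eventually_mono, intro impI)
    fix x assume x: "\<forall>K\<in>?\<F>. x \<in> K \<longrightarrow> \<bar>f x\<bar> \<le> B K" "x \<in> S"
    have "x \<in> \<Union>\<T>" using torus_triangulation_cover[OF T] by simp
    then obtain K where K: "K \<in> ?\<F>" "x \<in> K" using x(2) by auto
    have "\<bar>f x\<bar> \<le> \<bar>B K\<bar>" using x(1) K by fastforce
    also have "\<dots> \<le> (\<Sum>K\<in>?\<F>. \<bar>B K\<bar>)"
      by (rule member_le_sum[OF K(1)]) (auto simp: fin)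
    finally show "\<bar>f x\<bar> \<le> (\<Sum>K\<in>?\<F>. \<bar>B K\<bar>)" .
  qed
  then show ?thesis ..
qed

lemma pw_poly_vec_measurable:
  fixes f :: "vec3 \<Rightarrow> 'b::euclidean_space"
  assumes T: "torus_triangulation \<T>" and f: "\<And>b. b \<in> Basis \<Longrightarrow> pw_poly \<T> m (\<lambda>x. f x \<bullet> b)"
  shows "f \<in> borel_measurable lebesgue"
  by (subst borel_measurable_euclidean_space) (use pw_poly_measurable[OF T f] in auto)

lemma pw_poly_vec_bounded:
  fixes f :: "vec3 \<Rightarrow> 'b::euclidean_space"
  assumes T: "torus_triangulation \<T>" and f: "\<And>b. b \<in> Basis \<Longrightarrow> pw_poly \<T> m (\<lambda>x. f x \<bullet> b)"
    and S: "bounded S"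
  shows "\<exists>B. AE x in lebesgue. x \<in> S \<longrightarrow> norm (f x) \<le> B"
proof -
  have "\<forall>b\<in>Basis. \<exists>B. AE x in lebesgue. x \<in> S \<longrightarrow> \<bar>f x \<bullet> b\<bar> \<le> B"
    by (rule ballI, rule pw_poly_bounded[OF T f S])
  then obtain B where B: "\<And>b. b \<in> Basis \<Longrightarrow> AE x in lebesgue. x \<in> S \<longrightarrow> \<bar>f x \<bullet> b\<bar> \<le> B b"
    unfolding bchoice_iff by blast
  then have "AE x in lebesgue. \<forall>b\<in>Basis. x \<in> S \<longrightarrow> \<bar>f x \<bullet> b\<bar> \<le> B b"
    by (intro AE_finite_allI) auto
  then have "AE x in lebesgue. x \<in> S \<longrightarrow> norm (f x) \<le> (\<Sum>b\<in>Basis. B b)"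
    by (rule eventually_mono) (auto intro!: order_trans[OF norm_le_l1] sum_mono)
  then show ?thesis ..
qed

lemma emeasure_compact_lebesgue: "compact C \<Longrightarrow> emeasure lebesgue (C :: vec3 set) < \<infinity>"
  using emeasure_compact_finite[of C] by (simp add: compact_imp_closed)

lemma pw_poly_locally_integrable:
  fixes f :: "vec3 \<Rightarrow> 'b::euclidean_space"
  assumes T: "torus_triangulation \<T>" and f: "\<And>b. b \<in> Basis \<Longrightarrow> pw_poly \<T> m (\<lambda>x. f x \<bullet> b)"
  shows "locally_integrable f"
  unfolding locally_integrable_def set_integrable_def
proof (intro allI impI)
  fix C :: "vec3 set" assume C: "compact C"
  obtain B where "AE x in lebesgue. x \<in> C \<longrightarrow> norm (f x) \<le> B"
    using pw_poly_vec_bounded[OF T f compact_imp_bounded[OF C]] ..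
  then show "integrable lebesgue (\<lambda>x. indicator C x *\<^sub>R f x)"
    using C pw_poly_vec_measurable[OF T f]
    by (intro integrableI_bounded_set_indicator emeasure_compact_lebesgue) (auto simp: compact_imp_closed)
qed

lemma compact_unit_cell: "compact unit_cell"
proof -
  have "unit_cell = cbox 0 (1 :: vec3)"
    by (auto simp: unit_cell_def mem_box_cart)
  then show ?thesis using compact_cbox by metis
qed

lemma unit_cell_measurable [measurable]: "unit_cell \<in> sets lebesgue"
  using compact_unit_cell by (simp add: compact_imp_closed)

lemma L2_torus_if_pw_poly:
  fixes f :: "vec3 \<Rightarrow> 'b::euclidean_space"
  assumes T: "torus_triangulation \<T>" and f: "\<And>b. b \<in> Basis \<Longrightarrow> pw_poly \<T> m (\<lambda>x. f x \<bullet> b)"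
    and per: "periodic f"
  shows "f \<in> L2_torus"
proof -
  have [measurable]: "f \<in> borel_measurable lebesgue"
    by (rule pw_poly_vec_measurable[OF T f])
  obtain B where "AE x in lebesgue. x \<in> unit_cell \<longrightarrow> norm (f x) \<le> B"
    using pw_poly_vec_bounded[OF T f compact_imp_bounded[OF compact_unit_cell]] ..
  then have "AE x in lebesgue. x \<in> unit_cell \<longrightarrow> norm ((norm (f x))\<^sup>2) \<le> B\<^sup>2"
    by (rule eventually_mono) (auto intro: power_mono)
  then have "set_integrable lebesgue unit_cell (\<lambda>x. (norm (f x))\<^sup>2)"
    unfolding set_integrable_def
    by (intro integrableI_bounded_set_indicator emeasure_compact_lebesgue compact_unit_cell
        unit_cell_measurable) auto
  then show ?thesis
    using per by (auto simp: L2_torus_def)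
qed

text \<open>Square integrability over the cell comes for free, since piecewise polynomials are
  essentially bounded on bounded sets. In the converse direction the coordinate polynomials are
  assembled along the finite basis, so only finitely many null sets are discarded.\<close>

lemma L2_piecewise_poly_iff:
  fixes f :: "vec3 \<Rightarrow> 'b::euclidean_space"
  assumes T: "torus_triangulation \<T>"
  shows "f \<in> L2_piecewise_poly \<T> m \<longleftrightarrow> periodic f \<and> (\<forall>b\<in>Basis. pw_poly \<T> m (\<lambda>x. f x \<bullet> b))"
proof
  assume f: "f \<in> L2_piecewise_poly \<T> m"
  have "pw_poly \<T> m (\<lambda>x. f x \<bullet> b)" if b: "b \<in> Basis" for b
  proof (rule pw_polyI)
    fix K assume "K \<in> \<T>"
    then obtain q where "vpoly m q" "AE x in lebesgue. x \<in> K \<longrightarrow> f x = q x"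
      using f by (auto simp: L2_piecewise_poly_def)
    then show "\<exists>q. poly_fun m q \<and> (AE x in lebesgue. x \<in> K \<longrightarrow> f x \<bullet> b = q x)"
      using b by (intro exI[of _ "\<lambda>x. q x \<bullet> b"]) (auto simp: vpoly_def elim: eventually_mono)
  qed
  then show "periodic f \<and> (\<forall>b\<in>Basis. pw_poly \<T> m (\<lambda>x. f x \<bullet> b))"
    using f by (auto simp: L2_piecewise_poly_def L2_torus_def)
next
  assume f: "periodic f \<and> (\<forall>b\<in>Basis. pw_poly \<T> m (\<lambda>x. f x \<bullet> b))"
  have "\<exists>q. vpoly m q \<and> (AE x in lebesgue. x \<in> K \<longrightarrow> f x = q x)" if K: "K \<in> \<T>" for K
  proof -
    have "\<forall>b\<in>Basis. \<exists>q. poly_fun m q \<and> (AE x in lebesgue. x \<in> K \<longrightarrow> f x \<bullet> b = q x)"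
      using f K unfolding pw_poly_def by simp
    then obtain q where q: "\<And>b. b \<in> Basis \<Longrightarrow> poly_fun m (q b)"
      "\<And>b. b \<in> Basis \<Longrightarrow> AE x in lebesgue. x \<in> K \<longrightarrow> f x \<bullet> b = q b x"
      unfolding bchoice_iff by blast
    let ?q = "\<lambda>x. \<Sum>b\<in>Basis. q b x *\<^sub>R b"
    have "vpoly m ?q"
      using q(1) by (simp add: vpoly_def)
    moreover have "AE x in lebesgue. \<forall>b\<in>Basis. x \<in> K \<longrightarrow> f x \<bullet> b = q b x"
      using q(2) by (intro AE_finite_allI) auto
    then have "AE x in lebesgue. x \<in> K \<longrightarrow> f x = ?q x"
      by (rule eventually_mono) (auto simp: euclidean_eq_iff[where 'a='b])
    ultimately show ?thesis by blast
  qed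
  then show "f \<in> L2_piecewise_poly \<T> m"
    using f L2_torus_if_pw_poly[OF T, of m f] by (auto simp: L2_piecewise_poly_def)
qed

section \<open>The elementwise gradient\<close>

text \<open>Jump from \<open>a\<close> to the last point of a set of the cover containing \<open>a\<close>; by closedness, the
  remaining sets cover the rest of the interval including its left end point.\<close>

lemma lipschitz_of_finite_closed_cover:
  fixes g :: "real \<Rightarrow> real"
  assumes "finite \<C>" and "a \<le> b" and "{a..b} \<subseteq> \<Union>\<C>" and "\<And>C. C \<in> \<C> \<Longrightarrow> closed C"
    and "\<And>C s t. C \<in> \<C> \<Longrightarrow> s \<in> C \<Longrightarrow> t \<in> C \<Longrightarrow> \<bar>g s - g t\<bar> \<le> L * \<bar>s - t\<bar>"
  shows "\<bar>g b - g a\<bar> \<le> L * (b - a)"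
  using assms
proof (induction "card \<C>" arbitrary: \<C> a)
  case 0
  then show ?case by auto
next
  case (Suc n)
  from Suc.prems obtain C where C: "C \<in> \<C>" "a \<in> C" by auto
  define s where "s = Sup (C \<inter> {a..b})"
  have cl: "closed (C \<inter> {a..b})" and ne: "C \<inter> {a..b} \<noteq> {}" and bdd: "bdd_above (C \<inter> {a..b})"
    using C Suc.prems by auto
  have s: "s \<in> C \<inter> {a..b}"
    unfolding s_def by (rule closed_contains_Sup[OF ne bdd cl])
  have up: "t \<le> s" if "t \<in> C \<inter> {a..b}" for t
    unfolding s_def by (rule cSup_upper[OF that bdd])
  have 1: "\<bar>g s - g a\<bar> \<le> L * (s - a)"
    using Suc.prems(5)[OF C(1), of s a] s C by auto
  show ?case
  proof (cases "s = b")
    case True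
    then show ?thesis using 1 by simp
  next
    case False
    then have sb: "s < b" using s by auto
    have "{s<..b} \<subseteq> \<Union>(\<C> - {C})"
    proof
      fix t assume t: "t \<in> {s<..b}"
      then have "t \<in> {a..b}" "t \<notin> C" using s up[of t] by auto
      then show "t \<in> \<Union>(\<C> - {C})" using Suc.prems(3) by blast
    qed
    then have "closure {s<..b} \<subseteq> \<Union>(\<C> - {C})"
      using Suc.prems by (intro closure_minimal closed_Union) auto
    then have "{s..b} \<subseteq> \<Union>(\<C> - {C})"
      using sb by simp
    moreover have "n = card (\<C> - {C})"
      using Suc.hyps(2) Suc.prems(1) C by simp
    ultimately have "\<bar>g b - g s\<bar> \<le> L * (b - s)"
      using Suc.prems sb by (intro Suc.hyps(1)) auto
    with 1 show ?thesis by (simp add: algebra_simps)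
  qed
qed

lemma periodic_has_derivative_shift:
  assumes v: "periodic v" and z: "z \<in> int_lattice"
  shows "(v has_derivative D) (at (x + z)) \<longleftrightarrow> (v has_derivative D) (at x)"
proof
  have shift: "((\<lambda>x. x + z) has_derivative (\<lambda>h. h)) (at x)" "((\<lambda>x. x - z) has_derivative (\<lambda>h. h)) (at x)" for x
    by (auto intro!: derivative_eq_intros)
  have eq: "v (y + z) = v y" "v (y - z) = v y" for y
  proof -
    have "v (y + z) = v y" for y using v z by (simp add: periodic_def)
    from this[of y] this[of "y - z"] show "v (y + z) = v y" "v (y - z) = v y" by simp_all
  qed
  show "(v has_derivative D) (at x)" if "(v has_derivative D) (at (x + z))"
    using has_derivative_compose[OF shift(1) that] by (simp add: eq)
  show "(v has_derivative D) (at (x + z))" if "(v has_derivative D) (at x)"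
    using has_derivative_compose[OF shift(2)[of "x + z"], of v D] that by (simp add: eq)
qed

text \<open>Periodicity holds even where \<open>v\<close> is not differentiable: the Hilbert choice defining
  \<open>frechet_derivative\<close> is applied to the same predicate at \<open>x\<close> and at \<open>x + z\<close>.\<close>

lemma periodic_nabla:
  assumes "periodic v" shows "periodic (nabla v)"
  unfolding periodic_def nabla_def jacobian_def frechet_derivative_def
  by (simp add: periodic_has_derivative_shift[OF assms])

lemma nabla_nth:
  assumes "(v has_derivative D) (at x)"
  shows "nabla v x $ i $ \<alpha> = D (axis \<alpha> 1) $ i"
  using frechet_derivative_at[OF assms] by (simp add: nabla_def jacobian_def matrix_def)

text \<open>The frontier of a convex set is null. The interior is where \<open>v\<close> can be
  differentiated through its polynomial.\<close>

lemma AE_interior: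
  assumes "torus_triangulation \<T>" "K \<in> \<T>"
  shows "AE x in lebesgue. x \<in> K \<longrightarrow> x \<in> interior K"
proof -
  have "negligible (frontier K)"
    by (rule negligible_convex_frontier[OF torus_triangulation_convex[OF assms]])
  then have "AE x in lebesgue. x \<notin> frontier K"
    by (intro AE_not_in) (simp add: negligible_iff_null_sets)
  then show ?thesis
    by (rule eventually_mono) (use closure_subset in \<open>auto simp: frontier_def\<close>)
qed

lemma U_h_component_poly:
  assumes "v \<in> U_h \<T> k" "K \<in> \<T>"
  obtains q where "poly_fun k q" "\<And>x. x \<in> K \<Longrightarrow> v x $ i = q x"
proof -
  obtain q where "vpoly k q" "\<forall>x\<in>K. v x = q x"
    using assms unfolding U_h_def by blast
  then show thesis
    by (intro that[of "\<lambda>x. q x \<bullet> axis i 1"])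
       (auto simp: vpoly_def inner_axis Basis_vec_def)
qed

text \<open>In the interior of \<open>K\<close> the function coincides with a polynomial on an open
  neighbourhood and inherits its derivative. The coefficients \<open>p\<close> are quantified before
  \<open>x\<close>, because one polynomial has to serve the whole element.\<close>

lemma U_h_has_derivative:
  assumes v: "v \<in> U_h \<T> k" and K: "K \<in> \<T>"
  shows "\<exists>p. (\<forall>i \<alpha>. poly_fun (k - 1) (p i \<alpha>)) \<and>
    (\<forall>x\<in>interior K. (v has_derivative (\<lambda>h. \<chi> i. \<Sum>\<alpha>\<in>UNIV. p i \<alpha> x * h $ \<alpha>)) (at x))"
proof -
  have "\<exists>p. (\<forall>\<alpha>. poly_fun (k - 1) (p \<alpha>)) \<and>
      (\<forall>x\<in>interior K. ((\<lambda>x. v x $ i) has_derivative (\<lambda>h. \<Sum>\<alpha>\<in>UNIV. p \<alpha> x * h $ \<alpha>)) (at x))" for i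
  proof -
    obtain q where q: "poly_fun k q" "\<And>x. x \<in> K \<Longrightarrow> v x $ i = q x"
      using U_h_component_poly[OF v K, of i] by metis
    obtain p where p: "\<And>\<alpha>. poly_fun (k - 1) (p \<alpha>)"
      "\<And>x. (q has_derivative (\<lambda>h. \<Sum>\<alpha>\<in>UNIV. p \<alpha> x * h $ \<alpha>)) (at x)"
      using poly_fun_has_derivative[OF q(1)] by metis
    have "((\<lambda>x. v x $ i) has_derivative (\<lambda>h. \<Sum>\<alpha>\<in>UNIV. p \<alpha> x * h $ \<alpha>)) (at x)"
      if "x \<in> interior K" for x
      by (rule has_derivative_transform_within_open[OF p(2) open_interior that])
         (rule q(2)[OF subsetD[OF interior_subset], symmetric])
    with p(1) show ?thesis by (intro exI[of _ p]) simp
  qed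
  then have "\<exists>p. \<forall>i. (\<forall>\<alpha>. poly_fun (k - 1) (p i \<alpha>)) \<and>
      (\<forall>x\<in>interior K. ((\<lambda>x. v x $ i) has_derivative (\<lambda>h. \<Sum>\<alpha>\<in>UNIV. p i \<alpha> x * h $ \<alpha>)) (at x))"
    by (intro choice allI)
  then obtain p where p: "\<forall>i. (\<forall>\<alpha>. poly_fun (k - 1) (p i \<alpha>)) \<and>
      (\<forall>x\<in>interior K. ((\<lambda>x. v x $ i) has_derivative (\<lambda>h. \<Sum>\<alpha>\<in>UNIV. p i \<alpha> x * h $ \<alpha>)) (at x))"
    by (elim exE)
  have "(v has_derivative (\<lambda>h. \<chi> i. \<Sum>\<alpha>\<in>UNIV. p i \<alpha> x * h $ \<alpha>)) (at x)" if x: "x \<in> interior K" for x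
  proof (subst has_derivative_componentwise_within, rule ballI)
    fix b :: vec3 assume "b \<in> Basis"
    then obtain i where b: "b = axis i 1" by (auto simp: Basis_vec_def)
    show "((\<lambda>x. v x \<bullet> b) has_derivative (\<lambda>h. (\<chi> i. \<Sum>\<alpha>\<in>UNIV. p i \<alpha> x * h $ \<alpha>) \<bullet> b)) (at x)"
      using p[THEN spec, of i] x unfolding b inner_axis by simp
  qed
  with p show ?thesis by (intro exI[of _ p]) simp
qed

lemma pw_poly_nabla:
  assumes T: "torus_triangulation \<T>" and v: "v \<in> U_h \<T> k"
  shows "pw_poly \<T> (k - 1) (\<lambda>x. nabla v x $ i $ \<alpha>)"
proof (rule pw_polyI)
  fix K assume K: "K \<in> \<T>"
  obtain p where p: "\<forall>i \<alpha>. poly_fun (k - 1) (p i \<alpha>)"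
    and der: "\<forall>x\<in>interior K. (v has_derivative (\<lambda>h. \<chi> i. \<Sum>\<alpha>\<in>UNIV. p i \<alpha> x * h $ \<alpha>)) (at x)"
    using U_h_has_derivative[OF v K] by (elim exE conjE)
  have "nabla v x $ i $ \<alpha> = p i \<alpha> x" if "x \<in> interior K" for x
  proof -
    have "nabla v x $ i $ \<alpha> = (\<Sum>\<beta>\<in>UNIV. p i \<beta> x * axis \<alpha> 1 $ \<beta>)"
      using nabla_nth[OF bspec[OF der that], of i \<alpha>] by simp
    also have "\<dots> = (\<Sum>\<beta>\<in>{\<alpha>}. p i \<beta> x * axis \<alpha> 1 $ \<beta>)"
      by (intro sum.mono_neutral_right) (auto simp: axis_def)
    finally show ?thesis by (simp add: axis_def)
  qed
  then have "AE x in lebesgue. x \<in> K \<longrightarrow> nabla v x $ i $ \<alpha> = p i \<alpha> x"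
    using AE_interior[OF T K] by (auto elim: eventually_mono)
  with p[THEN spec, THEN spec] show "\<exists>q. poly_fun (k - 1) q \<and> (AE x in lebesgue. x \<in> K \<longrightarrow> nabla v x $ i $ \<alpha> = q x)"
    by (intro exI[of _ "p i \<alpha>"] conjI)
qed

text \<open>Countability of the triangulation lets all the null frontiers be discarded at
  once.\<close>

lemma AE_U_h_differentiable:
  assumes T: "torus_triangulation \<T>" and v: "v \<in> U_h \<T> k"
  shows "AE x in lebesgue. v differentiable (at x)"
proof -
  have "AE x in lebesgue. \<forall>K\<in>\<T>. x \<in> K \<longrightarrow> x \<in> interior K"
    using AE_interior[OF T] by (subst AE_ball_countable[OF torus_triangulation_countable[OF T]]) auto
  then show ?thesis
  proof (rule eventually_mono)
    fix x assume x: "\<forall>K\<in>\<T>. x \<in> K \<longrightarrow> x \<in> interior K"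
    have "x \<in> \<Union>\<T>" using torus_triangulation_cover[OF T] by simp
    then obtain K where K: "K \<in> \<T>" "x \<in> interior K" using x by blast
    show "v differentiable (at x)"
      using U_h_has_derivative[OF v K(1)] K(2) unfolding differentiable_def by meson
  qed
qed

text \<open>The elements cut the segment between two points of the ball into finitely many closed
  pieces, and on each piece \<open>v\<close> is a Lipschitz polynomial. Since \<open>v\<close>
  equals the polynomial on the whole closed element, the estimates join across faces.\<close>

lemma U_h_locally_lipschitz:
  assumes T: "torus_triangulation \<T>" and v: "v \<in> U_h \<T> k"
  shows "\<exists>L. \<forall>x\<in>cball 0 R. \<forall>y\<in>cball 0 R. \<bar>v x $ i - v y $ i\<bar> \<le> L * norm (x - y)"
proof -
  let ?\<F> = "{K \<in> \<T>. K \<inter> cball 0 R \<noteq> {}}"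
  have fin: "finite ?\<F>" by (rule torus_triangulation_locally_finite[OF T bounded_cball])
  have "\<exists>L. \<forall>x\<in>K. \<forall>y\<in>K. \<bar>v x $ i - v y $ i\<bar> \<le> L * norm (x - y)" if K: "K \<in> \<T>" for K
  proof -
    obtain q where q: "poly_fun k q" "\<And>x. x \<in> K \<Longrightarrow> v x $ i = q x"
      using U_h_component_poly[OF v K, of i] by metis
    obtain L where "\<And>x y. x \<in> K \<Longrightarrow> y \<in> K \<Longrightarrow> \<bar>q x - q y\<bar> \<le> L * norm (x - y)"
      using poly_fun_lipschitz[OF q(1) torus_triangulation_compact[OF T K] torus_triangulation_convex[OF T K]] by metis
    with q(2) show ?thesis by (intro exI[of _ L]) auto
  qed
  then have "\<exists>L. \<forall>K\<in>\<T>. \<forall>x\<in>K. \<forall>y\<in>K. \<bar>v x $ i - v y $ i\<bar> \<le> L K * norm (x - y)"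
    by (intro bchoice ballI)
  then obtain L where L: "\<And>K x y. K \<in> \<T> \<Longrightarrow> x \<in> K \<Longrightarrow> y \<in> K \<Longrightarrow>
      \<bar>v x $ i - v y $ i\<bar> \<le> L K * norm (x - y)"
    by blast
  \<comment> \<open>A single constant above every \<open>L K\<close>; the sum is finite because the
    ball meets finitely many elements.\<close>
  define M where "M = (\<Sum>K\<in>?\<F>. \<bar>L K\<bar>)"
  have LM: "L K \<le> M" if "K \<in> ?\<F>" for K
    unfolding M_def by (rule order_trans[OF abs_ge_self member_le_sum[OF that]]) (auto simp: fin)
  have "\<bar>v y $ i - v x $ i\<bar> \<le> M * norm (y - x)" if x: "x \<in> cball 0 R" and y: "y \<in> cball 0 R" for x y
  proof -
    define l where "l = (\<lambda>s. x + s *\<^sub>R (y - x))"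
    \<comment> \<open>Parameters grouped by element. The ball is convex, so the segment stays in it
      and the elements meeting the ball already cover \<open>{0..1}\<close>.\<close>
    define \<C> where "\<C> = (\<lambda>K. {0..1} \<inter> l -` K) ` ?\<F>"
    have l: "continuous_on {0..1} l"
      unfolding l_def by (intro continuous_intros)
    have "\<bar>v (l 1) $ i - v (l 0) $ i\<bar> \<le> (M * norm (y - x)) * (1 - 0)"
    proof (rule lipschitz_of_finite_closed_cover[where g = "\<lambda>s. v (l s) $ i" and \<C> = \<C>])
      show "finite \<C>" unfolding \<C>_def using fin by (rule finite_imageI)
      show "{0..1} \<subseteq> \<Union>\<C>"
      proof
        fix s :: real assume s: "s \<in> {0..1}"
        have "l s = (1 - s) *\<^sub>R x + s *\<^sub>R y"
          by (simp add: l_def algebra_simps)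
        then have "l s \<in> cball 0 R"
          using convexD_alt[OF convex_cball x y] s by auto
        moreover obtain K where "K \<in> \<T>" "l s \<in> K" using torus_triangulation_cover[OF T] by blast
        ultimately have "K \<in> ?\<F>" "s \<in> {0..1} \<inter> l -` K" using s by auto
        then show "s \<in> \<Union>\<C>" unfolding \<C>_def by blast
      qed
      show "closed C" if "C \<in> \<C>" for C
      proof -
        obtain K where K: "K \<in> \<T>" "C = {0..1} \<inter> l -` K" using \<open>C \<in> \<C>\<close> unfolding \<C>_def by auto
        have "closed K" by (rule compact_imp_closed[OF torus_triangulation_compact[OF T K(1)]])
        then show ?thesis
          unfolding K(2) by (intro continuous_closed_preimage[OF l]) auto
      qed
      show "\<bar>v (l s) $ i - v (l t) $ i\<bar> \<le> M * norm (y - x) * \<bar>s - t\<bar>"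
        if C: "C \<in> \<C>" and st: "s \<in> C" "t \<in> C" for C s t
      proof -
        obtain K where K: "K \<in> ?\<F>" "l s \<in> K" "l t \<in> K" using C st unfolding \<C>_def by auto
        have "\<bar>v (l s) $ i - v (l t) $ i\<bar> \<le> L K * norm (l s - l t)"
          using L K by simp
        also have "\<dots> \<le> M * norm (l s - l t)"
          by (rule mult_right_mono[OF LM[OF K(1)]]) simp
        also have "l s - l t = (s - t) *\<^sub>R (y - x)"
          by (simp add: l_def algebra_simps)
        finally show ?thesis by (simp add: mult_ac)
      qed
    qed simp
    then show ?thesis by (simp add: l_def)
  qed
  then show ?thesis by blast
qed

section \<open>Weak derivatives from difference quotients\<close>

text \<open>Borel measurability is assumed because the invariance is that of \<open>lborel\<close>,
  carried over to its completion.\<close>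

lemma lebesgue_integral_translation:
  fixes h :: "vec3 \<Rightarrow> real"
  assumes [measurable]: "h \<in> borel_measurable borel"
  shows "(LINT x|lebesgue. h (x + c)) = (LINT x|lebesgue. h x)"
proof -
  have "(LINT x|lborel. h x) = (LINT x|distr lborel borel ((+) c). h x)"
    by (simp add: lborel_distr_plus)
  also have "\<dots> = (LINT x|lborel. h (c + x))"
    by (rule integral_distr) auto
  finally show ?thesis
    by (simp add: integral_completion add.commute)
qed

lemma integrable_compact_support:
  fixes h :: "vec3 \<Rightarrow> real"
  assumes h: "continuous_on UNIV h" and C: "compact C" "\<And>x. x \<notin> C \<Longrightarrow> h x = 0"
  shows "integrable lebesgue h"
proof -
  have "integrable lborel (\<lambda>x. indicator C x *\<^sub>R h x)"
    by (rule borel_integrable_compact[OF C(1) continuous_on_subset[OF h]]) simp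
  also have "(\<lambda>x. indicator C x *\<^sub>R h x) = h"
    using C(2) by (auto simp: indicator_def fun_eq_iff)
  finally show ?thesis
    using borel_measurable_continuous_onI[OF h] by (simp add: integrable_completion)
qed

lemma continuous_lebesgue_measurable:
  "continuous_on UNIV (h :: vec3 \<Rightarrow> real) \<Longrightarrow> h \<in> borel_measurable lebesgue"
  by (rule measurable_completion) (simp add: borel_measurable_continuous_onI)

text \<open>Dominated convergence with majorant \<open>L * \<bar>w x\<bar>\<close>; the Lipschitz
  bound is asked for only on \<open>S\<close>, off which the weight vanishes. The weight is kept
  general because the lemma serves twice: once with \<open>w\<close> a test function, once with
  \<open>u\<close> the test function and \<open>w\<close> a truncation of the function to be
  differentiated.\<close>

lemma integral_difference_quotient_tendsto:
  fixes u w d :: "vec3 \<Rightarrow> real" and t :: "nat \<Rightarrow> real"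
  assumes u: "continuous_on UNIV u" and d: "d \<in> borel_measurable lebesgue"
    and w: "integrable lebesgue w" and supp: "\<And>x. x \<notin> S \<Longrightarrow> w x = 0"
    and lip: "\<And>x n. x \<in> S \<Longrightarrow> \<bar>u (x + t n *\<^sub>R e) - u x\<bar> \<le> L * \<bar>t n\<bar>"
    and der: "AE x in lebesgue. ((\<lambda>s. (u (x + s *\<^sub>R e) - u x) / s) \<longlongrightarrow> d x) (at 0)"
    and t: "t \<longlonglongrightarrow> 0" "\<And>n. t n \<noteq> 0"
  shows "(\<lambda>n. LINT x|lebesgue. (u (x + t n *\<^sub>R e) - u x) / t n * w x) \<longlonglongrightarrow> (LINT x|lebesgue. d x * w x)"
proof (rule integral_dominated_convergence[where w = "\<lambda>x. L * \<bar>w x\<bar>"])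
  have [measurable]: "w \<in> borel_measurable lebesgue" "d \<in> borel_measurable lebesgue"
    using w d by auto
  show "(\<lambda>x. d x * w x) \<in> borel_measurable lebesgue" by measurable
  show "(\<lambda>x. (u (x + t n *\<^sub>R e) - u x) / t n * w x) \<in> borel_measurable lebesgue" for n
  proof -
    have [measurable]: "(\<lambda>x. (u (x + t n *\<^sub>R e) - u x) / t n) \<in> borel_measurable lebesgue"
      by (intro continuous_lebesgue_measurable continuous_intros continuous_on_compose2[OF u] u) (use t(2) in auto)
    show ?thesis by measurable
  qed
  show "integrable lebesgue (\<lambda>x. L * \<bar>w x\<bar>)" using w by simp
  show "AE x in lebesgue. (\<lambda>n. (u (x + t n *\<^sub>R e) - u x) / t n * w x) \<longlonglongrightarrow> d x * w x"
    using der
  proof (rule eventually_mono)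
    fix x assume "((\<lambda>s. (u (x + s *\<^sub>R e) - u x) / s) \<longlongrightarrow> d x) (at 0)"
    moreover have "filterlim t (at 0) sequentially"
      using t by (simp add: filterlim_at)
    ultimately have "(\<lambda>n. (u (x + t n *\<^sub>R e) - u x) / t n) \<longlonglongrightarrow> d x"
      by (rule filterlim_compose)
    then show "(\<lambda>n. (u (x + t n *\<^sub>R e) - u x) / t n * w x) \<longlonglongrightarrow> d x * w x"
      by (intro tendsto_mult tendsto_const)
  qed
  show "AE x in lebesgue. norm ((u (x + t n *\<^sub>R e) - u x) / t n * w x) \<le> L * \<bar>w x\<bar>" for n
  proof (rule AE_I2)
    fix x
    show "norm ((u (x + t n *\<^sub>R e) - u x) / t n * w x) \<le> L * \<bar>w x\<bar>"
    proof (cases "x \<in> S")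
      case True
      then have "\<bar>u (x + t n *\<^sub>R e) - u x\<bar> / \<bar>t n\<bar> \<le> L"
        using lip t(2) by (simp add: divide_le_eq)
      then have "\<bar>u (x + t n *\<^sub>R e) - u x\<bar> / \<bar>t n\<bar> * \<bar>w x\<bar> \<le> L * \<bar>w x\<bar>"
        by (rule mult_right_mono) simp
      then show ?thesis by (simp add: abs_mult)
    qed (simp add: supp)
  qed
qed

lemma line_has_derivative:
  fixes u :: "vec3 \<Rightarrow> real"
  assumes "(u has_derivative D) (at (x + s *\<^sub>R e))"
  shows "((\<lambda>s. u (x + s *\<^sub>R e)) has_real_derivative D e) (at s)"
proof -
  have "((\<lambda>s. x + s *\<^sub>R e) has_derivative (\<lambda>h. h *\<^sub>R e)) (at s)"
    by (auto intro!: derivative_eq_intros)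
  from has_derivative_compose[OF this assms]
  have "((\<lambda>s. u (x + s *\<^sub>R e)) has_derivative (\<lambda>h. D (h *\<^sub>R e))) (at s)" .
  also have "(\<lambda>h. D (h *\<^sub>R e)) = (\<lambda>h. D e * h)"
    using linear_scale[OF has_derivative_linear[OF assms]] by (simp add: fun_eq_iff)
  finally show ?thesis by (simp add: has_field_derivative_def)
qed

lemma difference_quotient_tendsto:
  fixes u :: "vec3 \<Rightarrow> real"
  assumes "(u has_derivative D) (at x)"
  shows "((\<lambda>s. (u (x + s *\<^sub>R e) - u x) / s) \<longlongrightarrow> D e) (at 0)"
  using line_has_derivative[of u D x 0 e] assms by (simp add: has_field_derivative_iff)

lemma test_function_differentiable:
  assumes "test_function \<phi>"
  shows "(\<phi> has_derivative frechet_derivative \<phi> (at x)) (at x)"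
proof -
  have "C_k 1 \<phi>" using assms by (simp add: test_function_def)
  then show ?thesis by (simp add: frechet_derivative_works)
qed

lemma test_function_continuous: "test_function \<phi> \<Longrightarrow> continuous_on UNIV \<phi>"
  by (meson has_derivative_continuous continuous_at_imp_continuous_on test_function_differentiable)

lemma test_function_dir_deriv_continuous:
  assumes "test_function \<phi>" "e \<in> Basis"
  shows "continuous_on UNIV (dir_deriv e \<phi>)"
proof -
  have "C_k 1 \<phi>" using assms(1) unfolding test_function_def by blast
  with assms(2) show ?thesis by simp
qed

lemma dir_deriv_outside_support:
  assumes "compact C" "\<And>x. x \<notin> C \<Longrightarrow> \<phi> x = 0" "x \<notin> C"
  shows "dir_deriv e \<phi> x = 0"
proof -
  have "((\<lambda>_. 0) has_derivative (\<lambda>_. 0)) (at x)" by simp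
  then have "(\<phi> has_derivative (\<lambda>_. 0)) (at x)"
    by (rule has_derivative_transform_within_open[OF _ open_Compl[OF compact_imp_closed[OF assms(1)]]])
       (use assms in auto)
  then show ?thesis
    unfolding dir_deriv_def using frechet_derivative_at by metis
qed

lemma weak_derivative_if_AE_derivative:
  fixes f g \<phi> :: "vec3 \<Rightarrow> real"
  assumes f: "continuous_on UNIV f" and g: "g \<in> borel_measurable lebesgue"
    and lip: "\<And>R. \<exists>L. \<forall>x\<in>cball 0 R. \<forall>y\<in>cball 0 R. \<bar>f x - f y\<bar> \<le> L * norm (x - y)"
    and der: "AE x in lebesgue. ((\<lambda>s. (f (x + s *\<^sub>R e) - f x) / s) \<longlongrightarrow> g x) (at 0)"
    and \<phi>: "test_function \<phi>" and e: "e \<in> Basis"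
  shows "(LINT x|lebesgue. g x * \<phi> x) = - (LINT x|lebesgue. f x * dir_deriv e \<phi> x)"
proof -
  obtain C where C: "compact C" "\<And>x. x \<notin> C \<Longrightarrow> \<phi> x = 0"
    using \<phi> unfolding test_function_def by blast
  obtain R where R: "\<And>x. x \<in> C \<Longrightarrow> norm x \<le> R"
    using compact_imp_bounded[OF C(1)] unfolding bounded_iff by blast
  have e1: "norm e = 1" using e by simp
  note cont = test_function_continuous[OF \<phi>]
  \<comment> \<open>Steps of size at most 1 keep all translated supports in one fixed ball.\<close>
  define t where "t = (\<lambda>n. 1 / real (Suc n))"
  have t: "t \<longlonglongrightarrow> 0" "t n \<noteq> 0" "\<bar>t n\<bar> \<le> 1" for n
    using LIMSEQ_inverse_real_of_nat unfolding t_def by (auto simp: inverse_eq_divide)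
  \<comment> \<open>\<open>f\<close> itself need not be integrable. The supports of
    \<open>\<phi>\<close> and of its translates by at most 1 lie in this ball, so the truncation
    changes none of the products with them.\<close>
  define w where "w = (\<lambda>x. indicator (cball 0 (R + 1)) x * f x)"
  obtain L where L: "\<And>x y. x \<in> cball 0 (R + 1) \<Longrightarrow> y \<in> cball 0 (R + 1) \<Longrightarrow> \<bar>f x - f y\<bar> \<le> L * norm (x - y)"
    using lip by blast
  have lim1: "(\<lambda>n. LINT x|lebesgue. (f (x + t n *\<^sub>R e) - f x) / t n * \<phi> x) \<longlonglongrightarrow> (LINT x|lebesgue. g x * \<phi> x)"
  proof (rule integral_difference_quotient_tendsto[OF f g _ _ _ der t(1) t(2)])
    show "integrable lebesgue \<phi>" by (rule integrable_compact_support[OF cont C])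
    show "\<phi> x = 0" if "x \<notin> C" for x using C(2)[OF that] .
    show "\<bar>f (x + t n *\<^sub>R e) - f x\<bar> \<le> L * \<bar>t n\<bar>" if x: "x \<in> C" for x n
    proof -
      have "norm (x + t n *\<^sub>R e) \<le> R + 1"
        using norm_triangle_ineq[of x "t n *\<^sub>R e"] R[OF x] t(3)[of n] e1 by simp
      then show ?thesis
        using L[of "x + t n *\<^sub>R e" x] R[OF x] e1 by simp
    qed
  qed
  \<comment> \<open>Radius \<open>R + 2\<close> reaches every \<open>x + s *\<^sub>R e\<close> with
    \<open>x\<close> in the ball carrying \<open>w\<close> and \<open>\<bar>s\<bar> \<le> 1\<close>,
    where the mean value bound for \<open>\<phi>\<close> is taken.\<close>
  have "bounded (dir_deriv e \<phi> ` cball 0 (R + 2))"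
    by (rule compact_imp_bounded[OF compact_continuous_image[OF continuous_on_subset[OF
          test_function_dir_deriv_continuous[OF \<phi> e]]]]) auto
  then obtain M where "\<forall>y\<in>dir_deriv e \<phi> ` cball 0 (R + 2). norm y \<le> M"
    unfolding bounded_iff ..
  then have M: "\<bar>dir_deriv e \<phi> x\<bar> \<le> M" if "x \<in> cball 0 (R + 2)" for x
    using that by simp
  have lim2: "(\<lambda>n. LINT x|lebesgue. (\<phi> (x + (- t n) *\<^sub>R e) - \<phi> x) / (- t n) * w x) \<longlonglongrightarrow>
      (LINT x|lebesgue. dir_deriv e \<phi> x * w x)"
  proof (rule integral_difference_quotient_tendsto[OF cont])
    show "dir_deriv e \<phi> \<in> borel_measurable lebesgue"
      by (rule continuous_lebesgue_measurable[OF test_function_dir_deriv_continuous[OF \<phi> e]])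
    have iw: "integrable lborel w"
      using borel_integrable_compact[OF compact_cball continuous_on_subset[OF f], of 0 "R + 1"]
      unfolding w_def by simp
    show "integrable lebesgue w"
      using iw integrable_completion[OF borel_measurable_integrable[OF iw]] by simp
    show "w x = 0" if "x \<notin> cball 0 (R + 1)" for x using that by (simp add: w_def)
    show "(\<lambda>n. - t n) \<longlonglongrightarrow> 0" using tendsto_minus[OF t(1)] by simp
    show "- t n \<noteq> 0" for n using t(2) by simp
    show "AE x in lebesgue. ((\<lambda>s. (\<phi> (x + s *\<^sub>R e) - \<phi> x) / s) \<longlongrightarrow> dir_deriv e \<phi> x) (at 0)"
      unfolding dir_deriv_def
      by (intro AE_I2 difference_quotient_tendsto test_function_differentiable[OF \<phi>])
    show "\<bar>\<phi> (x + (- t n) *\<^sub>R e) - \<phi> x\<bar> \<le> M * \<bar>- t n\<bar>" if x: "x \<in> cball 0 (R + 1)" for x n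
    proof -
      have "norm (\<phi> (x + (- t n) *\<^sub>R e) - \<phi> (x + 0 *\<^sub>R e)) \<le> M * norm (- t n - 0)"
      proof (rule field_differentiable_bound[where S = "{-1..1}" and f = "\<lambda>s. \<phi> (x + s *\<^sub>R e)"])
        fix s :: real assume s: "s \<in> {-1..1}"
        show "((\<lambda>s. \<phi> (x + s *\<^sub>R e)) has_field_derivative dir_deriv e \<phi> (x + s *\<^sub>R e)) (at s within {-1..1})"
          unfolding dir_deriv_def
          by (rule has_field_derivative_at_within[OF line_has_derivative[OF test_function_differentiable[OF \<phi>]]])
        have "norm (x + s *\<^sub>R e) \<le> R + 2"
          using norm_triangle_ineq[of x "s *\<^sub>R e"] x s e1 by auto
        then show "norm (dir_deriv e \<phi> (x + s *\<^sub>R e)) \<le> M"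
          using M by simp
      qed (use t(3)[of n] in auto)
      then show ?thesis by simp
    qed
  qed
  \<comment> \<open>Discrete integration by parts: a translation by \<open>t n *\<^sub>R e\<close>
    under the integral moves the shift from \<open>f\<close> to \<open>\<phi>\<close> and reverses
    it, hence the step \<open>- t n\<close> and the minus sign.\<close>
  have eq: "(LINT x|lebesgue. (f (x + t n *\<^sub>R e) - f x) / t n * \<phi> x) =
      - (LINT x|lebesgue. (\<phi> (x + (- t n) *\<^sub>R e) - \<phi> x) / (- t n) * w x)" for n
  proof -
    let ?c = "t n *\<^sub>R e"
    have tr: "continuous_on UNIV (\<lambda>x. f (x + ?c))" "continuous_on UNIV (\<lambda>x. \<phi> (x - ?c))"
      by (intro continuous_on_compose2[OF f] continuous_on_compose2[OF cont] continuous_intros; simp)+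
    have i1: "integrable lebesgue (\<lambda>x. f (x + ?c) * \<phi> x)" and i2: "integrable lebesgue (\<lambda>x. f x * \<phi> x)"
      using C(2) by (auto intro!: integrable_compact_support[OF _ C(1)] continuous_on_mult f cont tr)
    have i3: "integrable lebesgue (\<lambda>x. f x * \<phi> (x - ?c))"
    proof (rule integrable_compact_support[where C = "(\<lambda>x. x + ?c) ` C"])
      show "compact ((\<lambda>x. x + ?c) ` C)"
        by (intro compact_continuous_image continuous_intros C(1))
      show "f x * \<phi> (x - ?c) = 0" if "x \<notin> (\<lambda>x. x + ?c) ` C" for x
        using that C(2)[of "x - ?c"] by force
    qed (intro continuous_on_mult f tr)
    have "(\<lambda>x. f x * \<phi> (x - ?c)) \<in> borel_measurable borel"
      by (intro borel_measurable_continuous_onI continuous_on_mult f tr)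
    from lebesgue_integral_translation[OF this, of ?c]
    have shift: "(LINT x|lebesgue. f (x + ?c) * \<phi> x) = (LINT x|lebesgue. f x * \<phi> (x - ?c))"
      by simp
    have "(LINT x|lebesgue. (f (x + ?c) - f x) / t n * \<phi> x)
        = (LINT x|lebesgue. (1 / t n) * (f (x + ?c) * \<phi> x - f x * \<phi> x))"
      by (intro Bochner_Integration.integral_cong refl) (simp add: field_simps)
    also have "\<dots> = (1 / t n) * ((LINT x|lebesgue. f (x + ?c) * \<phi> x) - (LINT x|lebesgue. f x * \<phi> x))"
      using i1 i2 by simp
    also have "\<dots> = (1 / t n) * (LINT x|lebesgue. f x * \<phi> (x - ?c) - f x * \<phi> x)"
      unfolding shift using i3 i2 by simp
    also have "\<dots> = - (LINT x|lebesgue. - (1 / t n) * (f x * \<phi> (x - ?c) - f x * \<phi> x))"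
      by simp
    also have "(LINT x|lebesgue. - (1 / t n) * (f x * \<phi> (x - ?c) - f x * \<phi> x))
        = (LINT x|lebesgue. (\<phi> (x + (- t n) *\<^sub>R e) - \<phi> x) / (- t n) * w x)"
    proof (intro Bochner_Integration.integral_cong refl)
      fix x
      have "\<phi> x = 0 \<and> \<phi> (x - ?c) = 0" if "x \<notin> cball 0 (R + 1)"
      proof -
        have "norm x > R + 1" using that by simp
        moreover have "norm x \<le> norm (x - ?c) + 1"
          using norm_triangle_ineq[of "x - ?c" ?c] t(3)[of n] e1 by simp
        ultimately have "x \<notin> C" "x - ?c \<notin> C"
          using R[of x] R[of "x - ?c"] by auto
        then show ?thesis using C(2) by simp
      qed
      then show "- (1 / t n) * (f x * \<phi> (x - ?c) - f x * \<phi> x)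
          = (\<phi> (x + (- t n) *\<^sub>R e) - \<phi> x) / (- t n) * w x"
        by (cases "x \<in> cball 0 (R + 1)") (simp_all add: w_def field_simps)
    qed
    finally show ?thesis .
  qed
  have "(LINT x|lebesgue. g x * \<phi> x) = - (LINT x|lebesgue. dir_deriv e \<phi> x * w x)"
    by (rule LIMSEQ_unique[OF lim1]) (unfold eq, rule tendsto_minus[OF lim2])
  \<comment> \<open>The truncation is undone: on \<open>C\<close> it is the identity, and off the
    closed set \<open>C\<close> the derivative of \<open>\<phi>\<close> vanishes.\<close>
  also have "(\<lambda>x. dir_deriv e \<phi> x * w x) = (\<lambda>x. f x * dir_deriv e \<phi> x)"
  proof
    fix x
    show "dir_deriv e \<phi> x * w x = f x * dir_deriv e \<phi> x"
    proof (cases "x \<in> C")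
      case True
      then show ?thesis using R[OF True] by (simp add: w_def)
    next
      case False
      then show ?thesis using dir_deriv_outside_support[OF C False] by simp
    qed
  qed
  finally show ?thesis .
qed

section \<open>The derivative of the minors\<close>

text \<open>The derivative of \<open>cof\<close> at \<open>F\<close> in direction \<open>M\<close>,
  with the product rule already carried out, so that every summand is visibly an entry of
  \<open>M\<close> times an entry of \<open>F\<close>.\<close>

definition dcof :: "mat3 \<Rightarrow> mat3 \<Rightarrow> mat3" where
  "dcof F M = (\<chi> i \<alpha>. 1/2 * (\<Sum>j\<in>UNIV. \<Sum>k\<in>UNIV. \<Sum>\<beta>\<in>UNIV. \<Sum>\<gamma>\<in>UNIV.
     levi_civita i j k * levi_civita \<alpha> \<beta> \<gamma> * (M $ j $ \<beta> * F $ k $ \<gamma> + F $ j $ \<beta> * M $ k $ \<gamma>)))"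

text \<open>The derivative at \<open>F\<close>, in direction \<open>M\<close>, of the Leibniz monomial
  \<open>F $ 1 $ \<alpha> * F $ 2 $ \<beta> * F $ 3 $ \<gamma>\<close>.\<close>

definition dtriple :: "mat3 \<Rightarrow> mat3 \<Rightarrow> 3 \<Rightarrow> 3 \<Rightarrow> 3 \<Rightarrow> real" where
  "dtriple F M \<alpha> \<beta> \<gamma> = M $ 1 $ \<alpha> * (F $ 2 $ \<beta> * F $ 3 $ \<gamma>) + F $ 1 $ \<alpha> * (M $ 2 $ \<beta> * F $ 3 $ \<gamma>)
     + F $ 1 $ \<alpha> * (F $ 2 $ \<beta> * M $ 3 $ \<gamma>)"

text \<open>The derivative of the determinant, mathematically the contraction of
  \<open>cof F\<close> with \<open>M\<close>. It is kept as differentiated Leibniz terms so that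
  every summand is visibly a product of three entries.\<close>

definition ddet :: "mat3 \<Rightarrow> mat3 \<Rightarrow> real" where
  "ddet F M = dtriple F M 1 2 3 + dtriple F M 2 3 1 + dtriple F M 3 1 2
     - dtriple F M 1 3 2 - dtriple F M 2 1 3 - dtriple F M 3 2 1"

lemma has_derivative_entry:
  "((\<lambda>F :: mat3. F $ i $ \<alpha>) has_derivative (\<lambda>M. M $ i $ \<alpha>)) (at F)"
  by (intro bounded_linear_imp_has_derivative bounded_linear_compose[OF bounded_linear_vec_nth] bounded_linear_vec_nth)

lemma mat3_Basis_iff: "b \<in> (Basis :: mat3 set) \<longleftrightarrow> (\<exists>i \<alpha>. b = axis i (axis \<alpha> 1))"
  by (auto simp: Basis_vec_def)

lemma cof_has_derivative: "(cof has_derivative dcof F) (at F)"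
proof (subst has_derivative_componentwise_within, rule ballI)
  fix b :: mat3 assume "b \<in> Basis"
  then obtain i \<alpha> where b: "b = axis i (axis \<alpha> 1)" unfolding mat3_Basis_iff by blast
  have pair: "((\<lambda>F :: mat3. F $ j $ \<beta> * F $ k $ \<gamma>) has_derivative
      (\<lambda>M. M $ j $ \<beta> * F $ k $ \<gamma> + F $ j $ \<beta> * M $ k $ \<gamma>)) (at F)" for j k \<beta> \<gamma>
    using has_derivative_mult[OF has_derivative_entry[of j \<beta> F] has_derivative_entry[of k \<gamma> F]]
    by (simp add: add.commute)
  have "((\<lambda>F. 1/2 * (\<Sum>j\<in>UNIV. \<Sum>k\<in>UNIV. \<Sum>\<beta>\<in>UNIV. \<Sum>\<gamma>\<in>UNIV.
       levi_civita i j k * levi_civita \<alpha> \<beta> \<gamma> * (F $ j $ \<beta> * F $ k $ \<gamma>))) has_derivative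
     (\<lambda>M. 1/2 * (\<Sum>j\<in>UNIV. \<Sum>k\<in>UNIV. \<Sum>\<beta>\<in>UNIV. \<Sum>\<gamma>\<in>UNIV.
       levi_civita i j k * levi_civita \<alpha> \<beta> \<gamma> * (M $ j $ \<beta> * F $ k $ \<gamma> + F $ j $ \<beta> * M $ k $ \<gamma>)))) (at F)"
    by (intro has_derivative_mult_right has_derivative_sum pair)
  then show "((\<lambda>F. cof F \<bullet> b) has_derivative (\<lambda>M. dcof F M \<bullet> b)) (at F)"
    unfolding b inner_axis cof_def dcof_def by (simp only: vec_lambda_beta inner_real_def mult_1_right mult.assoc)
qed

lemma det_has_derivative: "(det has_derivative ddet F) (at (F :: mat3))"
proof -
  have tr: "((\<lambda>F :: mat3. F $ 1 $ \<alpha> * (F $ 2 $ \<beta> * F $ 3 $ \<gamma>)) has_derivative (\<lambda>M. dtriple F M \<alpha> \<beta> \<gamma>)) (at F)"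
    for \<alpha> \<beta> \<gamma>
    using has_derivative_mult[OF has_derivative_entry[of 1 \<alpha> F]
        has_derivative_mult[OF has_derivative_entry[of 2 \<beta> F] has_derivative_entry[of 3 \<gamma> F]]]
    by (simp add: dtriple_def algebra_simps)
  have det_eq: "det = (\<lambda>F :: mat3. F $ 1 $ 1 * (F $ 2 $ 2 * F $ 3 $ 3) + F $ 1 $ 2 * (F $ 2 $ 3 * F $ 3 $ 1)
      + F $ 1 $ 3 * (F $ 2 $ 1 * F $ 3 $ 2) - F $ 1 $ 1 * (F $ 2 $ 3 * F $ 3 $ 2)
      - F $ 1 $ 2 * (F $ 2 $ 1 * F $ 3 $ 3) - F $ 1 $ 3 * (F $ 2 $ 2 * F $ 3 $ 1))"
    by (simp add: fun_eq_iff det_3 mult.assoc)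
  have ddet_eq: "ddet F = (\<lambda>M. dtriple F M 1 2 3 + dtriple F M 2 3 1 + dtriple F M 3 1 2
     - dtriple F M 1 3 2 - dtriple F M 2 1 3 - dtriple F M 3 2 1)"
    by (simp add: fun_eq_iff ddet_def)
  show ?thesis
    unfolding det_eq ddet_eq by (intro has_derivative_add has_derivative_diff tr)
qed

lemma matrix_unit_expansion: "(\<Sum>i\<in>UNIV. \<Sum>\<alpha>\<in>UNIV. (M $ i $ \<alpha>) *\<^sub>R matrix_unit i \<alpha>) = M"
proof -
  have "(\<Sum>i\<in>UNIV. \<Sum>\<alpha>\<in>UNIV. (M $ i $ \<alpha>) *\<^sub>R matrix_unit i \<alpha>) $ j $ \<beta> = M $ j $ \<beta>" for j \<beta>
  proof -
    have "(\<Sum>i\<in>UNIV. \<Sum>\<alpha>\<in>UNIV. (M $ i $ \<alpha>) *\<^sub>R matrix_unit i \<alpha>) $ j $ \<beta>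
        = (\<Sum>i\<in>UNIV. \<Sum>\<alpha>\<in>UNIV. M $ i $ \<alpha> * matrix_unit i \<alpha> $ j $ \<beta>)"
      by simp
    also have "\<dots> = (\<Sum>i\<in>{j}. \<Sum>\<alpha>\<in>UNIV. M $ i $ \<alpha> * matrix_unit i \<alpha> $ j $ \<beta>)"
      by (intro sum.mono_neutral_right) (auto simp: matrix_unit_def axis_def)
    also have "\<dots> = (\<Sum>\<alpha>\<in>UNIV. M $ j $ \<alpha> * matrix_unit j \<alpha> $ j $ \<beta>)"
      by simp
    also have "\<dots> = (\<Sum>\<alpha>\<in>{\<beta>}. M $ j $ \<alpha> * matrix_unit j \<alpha> $ j $ \<beta>)"
      by (intro sum.mono_neutral_right) (auto simp: matrix_unit_def axis_def)
    finally show ?thesis by (simp add: matrix_unit_def axis_def)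
  qed
  then show ?thesis by (simp add: vec_eq_iff)
qed

text \<open>\<open>DPhi\<close> is built from the partial derivatives of \<open>Phi\<close>; as
  \<open>Phi\<close> is differentiable, linearity of its derivative sums them up to the derivative
  in direction \<open>M\<close>. The first slot is \<open>M\<close> itself because
  \<open>Phi\<close> is the identity there, which is the source of the separate equation for
  \<open>F1\<close>.\<close>

lemma DPhi_eq: "DPhi F M = (M, dcof F M, ddet F M)"
proof -
  let ?D = "\<lambda>M. (M, dcof F M, ddet F M)"
  have der: "(Phi has_derivative ?D) (at F)"
    unfolding Phi_def[abs_def]
    by (intro has_derivative_Pair cof_has_derivative det_has_derivative has_derivative_ident)
  then interpret linear ?D by (rule has_derivative_linear)
  have "DPhi F M = (\<Sum>i\<in>UNIV. \<Sum>\<alpha>\<in>UNIV. (M $ i $ \<alpha>) *\<^sub>R ?D (matrix_unit i \<alpha>))"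
    unfolding DPhi_def dir_deriv_def frechet_derivative_at[OF der, symmetric] ..
  also have "\<dots> = ?D (\<Sum>i\<in>UNIV. \<Sum>\<alpha>\<in>UNIV. (M $ i $ \<alpha>) *\<^sub>R matrix_unit i \<alpha>)"
    by (simp only: sum scale)
  finally show ?thesis by (simp only: matrix_unit_expansion)
qed

lemma pw_poly_dcof:
  assumes "\<And>i \<alpha>. pw_poly \<T> m (\<lambda>x. F x $ i $ \<alpha>)" "\<And>i \<alpha>. pw_poly \<T> m (\<lambda>x. M x $ i $ \<alpha>)"
  shows "pw_poly \<T> (2 * m) (\<lambda>x. dcof (F x) (M x) $ i $ \<alpha>)"
  unfolding dcof_def vec_lambda_beta mult_2
  by (intro pw_poly_cmult pw_poly_sum pw_poly_add pw_poly_mult assms)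

lemma pw_poly_ddet:
  assumes "\<And>i \<alpha>. pw_poly \<T> m (\<lambda>x. F x $ i $ \<alpha>)" "\<And>i \<alpha>. pw_poly \<T> m (\<lambda>x. M x $ i $ \<alpha>)"
  shows "pw_poly \<T> (3 * m) (\<lambda>x. ddet (F x) (M x))"
proof -
  \<comment> \<open>Matches the nesting of the products in \<open>dtriple\<close>, so that the
    degree rule for products applies directly.\<close>
  have "3 * m = m + (m + m)" by simp
  then show ?thesis
    unfolding ddet_def dtriple_def
    by (simp only:) (intro pw_poly_diff pw_poly_add pw_poly_mult assms)
qed

section \<open>The discrete state space\<close>

lemma L2_piecewise_poly_matrix_iff:
  fixes A :: "vec3 \<Rightarrow> mat3"
  assumes "torus_triangulation \<T>"
  shows "A \<in> L2_piecewise_poly \<T> m \<longleftrightarrow> periodic A \<and> (\<forall>i \<alpha>. pw_poly \<T> m (\<lambda>x. A x $ i $ \<alpha> :: real))"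
proof -
  have "(\<forall>b\<in>(Basis :: mat3 set). P b) \<longleftrightarrow> (\<forall>i \<alpha>. P (axis i (axis \<alpha> 1)))" for P
    unfolding Ball_def mat3_Basis_iff by blast
  then show ?thesis
    unfolding L2_piecewise_poly_iff[OF assms] by (simp add: inner_axis)
qed

lemma L2_piecewise_poly_real_iff:
  fixes d :: "vec3 \<Rightarrow> real"
  assumes "torus_triangulation \<T>"
  shows "d \<in> L2_piecewise_poly \<T> m \<longleftrightarrow> periodic d \<and> pw_poly \<T> m d"
  unfolding L2_piecewise_poly_iff[OF assms] by simp

lemma L2_piecewise_poly_diff:
  assumes "torus_triangulation \<T>" "f \<in> L2_piecewise_poly \<T> m" "g \<in> L2_piecewise_poly \<T> m"
  shows "(\<lambda>x. f x - g x) \<in> L2_piecewise_poly \<T> m"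
  using assms(2,3) unfolding L2_piecewise_poly_iff[OF assms(1)]
  by (auto simp: periodic_def inner_diff_left intro: pw_poly_diff)

lemma L2_piecewise_poly_scaleR:
  assumes "torus_triangulation \<T>" "f \<in> L2_piecewise_poly \<T> m"
  shows "(\<lambda>x. c *\<^sub>R f x) \<in> L2_piecewise_poly \<T> m"
  using assms(2) unfolding L2_piecewise_poly_iff[OF assms(1)]
  by (auto simp: periodic_def intro: pw_poly_cmult)

text \<open>\<open>H_h\<close> is a set of functions rather than of classes, so a triple field
  determines its three components at every point.\<close>

lemma H_h_iff:
  "(\<lambda>x. (A x, B x, d x)) \<in> H_h \<T> k \<longleftrightarrow> A \<in> HF_h \<T> k \<and> B \<in> HZ_h \<T> k \<and> d \<in> Hw_h \<T> k"
proof
  assume "(\<lambda>x. (A x, B x, d x)) \<in> H_h \<T> k"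
  then obtain A' B' d' where eq: "(\<lambda>x. (A x, B x, d x)) = (\<lambda>x. (A' x, B' x, d' x))"
    and mem: "A' \<in> HF_h \<T> k" "B' \<in> HZ_h \<T> k" "d' \<in> Hw_h \<T> k"
    unfolding H_h_def by blast
  have "A = A'" "B = B'" "d = d'"
    using eq by (auto simp: fun_eq_iff)
  with mem show "A \<in> HF_h \<T> k \<and> B \<in> HZ_h \<T> k \<and> d \<in> Hw_h \<T> k" by simp
qed (unfold H_h_def, blast)

lemma H_hE:
  assumes "f \<in> H_h \<T> k"
  obtains A B d where "f = (\<lambda>x. (A x, B x, d x))" "A \<in> HF_h \<T> k" "B \<in> HZ_h \<T> k" "d \<in> Hw_h \<T> k"
  using assms unfolding H_h_def by blast

lemma H_h_diff:
  assumes T: "torus_triangulation \<T>" and "f \<in> H_h \<T> k" "g \<in> H_h \<T> k"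
  shows "(\<lambda>x. f x - g x) \<in> H_h \<T> k"
proof -
  obtain A B d where f: "f = (\<lambda>x. (A x, B x, d x))" "A \<in> HF_h \<T> k" "B \<in> HZ_h \<T> k" "d \<in> Hw_h \<T> k"
    using H_hE[OF assms(2)] .
  obtain A' B' d' where g: "g = (\<lambda>x. (A' x, B' x, d' x))" "A' \<in> HF_h \<T> k" "B' \<in> HZ_h \<T> k" "d' \<in> Hw_h \<T> k"
    using H_hE[OF assms(3)] .
  from f(2-) g(2-) show ?thesis
    unfolding f(1) g(1) diff_Pair H_h_iff HF_h_def HZ_h_def Hw_h_def
    by (intro conjI L2_piecewise_poly_diff[OF T])
qed

lemma H_h_scaleR:
  assumes T: "torus_triangulation \<T>" and "f \<in> H_h \<T> k"
  shows "(\<lambda>x. c *\<^sub>R f x) \<in> H_h \<T> k"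
proof -
  obtain A B d where f: "f = (\<lambda>x. (A x, B x, d x))" "A \<in> HF_h \<T> k" "B \<in> HZ_h \<T> k" "d \<in> Hw_h \<T> k"
    using H_hE[OF assms(2)] .
  from f(2-) show ?thesis
    unfolding f(1) scaleR_Pair H_h_iff HF_h_def HZ_h_def Hw_h_def
    by (intro conjI L2_piecewise_poly_scaleR[OF T])
qed

lemma L2_torus_Pair:
  assumes "f \<in> L2_torus" "g \<in> L2_torus"
  shows "(\<lambda>x. (f x, g x)) \<in> L2_torus"
proof -
  have "set_integrable lebesgue unit_cell (\<lambda>x. (norm (f x))\<^sup>2 + (norm (g x))\<^sup>2)"
    using assms unfolding L2_torus_def by (intro set_integral_add(1)) auto
  moreover have "(\<lambda>x. (f x, g x)) \<in> borel_measurable lebesgue"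
    using assms unfolding L2_torus_def by (intro borel_measurable_Pair) auto
  moreover have "periodic (\<lambda>x. (f x, g x))"
    using assms unfolding L2_torus_def periodic_def by auto
  ultimately show ?thesis
    unfolding L2_torus_def by (simp add: norm_Pair)
qed

lemma H_h_L2_torus:
  assumes "f \<in> H_h \<T> k" shows "f \<in> L2_torus"
proof -
  obtain A B d where f: "f = (\<lambda>x. (A x, B x, d x))" "A \<in> HF_h \<T> k" "B \<in> HZ_h \<T> k" "d \<in> Hw_h \<T> k"
    using H_hE[OF assms] .
  then show ?thesis
    unfolding f(1) by (intro L2_torus_Pair) (auto simp: HF_h_def HZ_h_def Hw_h_def L2_piecewise_poly_def)
qed

section \<open>The \<open>L\<^sup>2\<close> inner product\<close>

lemma L2_torus_inner_integrable:
  assumes "f \<in> L2_torus" "g \<in> L2_torus"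
  shows "set_integrable lebesgue unit_cell (\<lambda>x. f x \<bullet> g x)"
proof -
  have [measurable]: "f \<in> borel_measurable lebesgue" "g \<in> borel_measurable lebesgue"
    using assms by (auto simp: L2_torus_def)
  have "set_integrable lebesgue unit_cell (\<lambda>x. (norm (f x))\<^sup>2 + (norm (g x))\<^sup>2)"
    using assms unfolding L2_torus_def by (intro set_integral_add(1)) auto
  then show ?thesis
    unfolding set_integrable_def
  proof (rule Bochner_Integration.integrable_bound)
    show "(\<lambda>x. indicator unit_cell x *\<^sub>R (f x \<bullet> g x)) \<in> borel_measurable lebesgue" by measurable
    have "\<bar>f x \<bullet> g x\<bar> \<le> (norm (f x))\<^sup>2 + (norm (g x))\<^sup>2" for x
      using Cauchy_Schwarz_ineq2[of "f x" "g x"] sum_squares_bound[of "norm (f x)" "norm (g x)"]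
        mult_nonneg_nonneg[OF norm_ge_zero norm_ge_zero, of "f x" "g x"] by linarith
    then show "AE x in lebesgue. norm (indicator unit_cell x *\<^sub>R (f x \<bullet> g x))
        \<le> norm (indicator unit_cell x *\<^sub>R ((norm (f x))\<^sup>2 + (norm (g x))\<^sup>2))"
      by (intro AE_I2) (simp add: abs_mult mult_left_mono)
  qed
qed

lemma L2_inner_diff_left:
  assumes "f \<in> L2_torus" "g \<in> L2_torus" "h \<in> L2_torus"
  shows "L2_inner (\<lambda>x. f x - g x) h = L2_inner f h - L2_inner g h"
  unfolding L2_inner_def inner_diff_left
  by (rule set_integral_diff(2)[OF L2_torus_inner_integrable[OF assms(1,3)] L2_torus_inner_integrable[OF assms(2,3)]])

text \<open>Every point is a lattice translate of a point of the cell. By periodicity the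
  exceptional set is covered by countably many translates of its part in the cell, each of them
  null.\<close>

lemma AE_of_periodic_cell:
  assumes f: "periodic f" and ae: "AE x in lebesgue. x \<in> unit_cell \<longrightarrow> f x = c"
  shows "AE x in lebesgue. f x = c"
proof -
  let ?N = "{x. \<not> (x \<in> unit_cell \<longrightarrow> f x = c)}"
  have "negligible ?N"
    using ae by (simp add: completion.AE_iff_null_sets negligible_iff_null_sets)
  then have "negligible (\<Union>z\<in>int_lattice. (+) z ` ?N)"
    by (intro negligible_countable_Union countable_image countable_int_lattice)
       (auto intro: negligible_translation)
  moreover have "{x. f x \<noteq> c} \<subseteq> (\<Union>z\<in>int_lattice. (+) z ` ?N)"
  proof
    fix x assume x: "x \<in> {x. f x \<noteq> c}"
    define z :: vec3 where "z = (\<chi> i. of_int \<lfloor>x $ i\<rfloor>)"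
    have z: "z \<in> int_lattice" by (simp add: z_def int_lattice_def)
    have "f ((x - z) + z) = f (x - z)" using f z unfolding periodic_def by blast
    then have "f (x - z) \<noteq> c" using x by simp
    moreover have "x - z \<in> unit_cell"
      unfolding unit_cell_def z_def by (auto intro: less_imp_le) linarith
    ultimately have "x \<in> (+) z ` ?N"
      by (intro image_eqI[of _ _ "x - z"]) auto
    with z show "x \<in> (\<Union>z\<in>int_lattice. (+) z ` ?N)" by blast
  qed
  ultimately have "negligible {x. f x \<noteq> c}"
    by (rule negligible_subset)
  then show ?thesis
    by (simp add: completion.AE_iff_null_sets negligible_iff_null_sets)
qed

lemma AE_zero_if_L2_inner_self_zero:
  assumes f: "f \<in> L2_torus" and zero: "L2_inner f f = 0"
  shows "AE x in lebesgue. f x = 0"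
proof (rule AE_of_periodic_cell)
  show "periodic f" using f by (simp add: L2_torus_def)
  have int: "integrable lebesgue (\<lambda>x. indicator unit_cell x *\<^sub>R (f x \<bullet> f x))"
    using L2_torus_inner_integrable[OF f f] unfolding set_integrable_def .
  have "AE x in lebesgue. indicator unit_cell x *\<^sub>R (f x \<bullet> f x) = 0"
    using zero by (subst integral_nonneg_eq_0_iff_AE[OF int, symmetric])
      (auto simp: L2_inner_def set_lebesgue_integral_def)
  then show "AE x in lebesgue. x \<in> unit_cell \<longrightarrow> f x = 0"
    by (rule eventually_mono) auto
qed

section \<open>Weak gradients\<close>

text \<open>\<open>T\<close> stands for the extraction of an entry, so that matrix fields and vector
  potentials are treated alike. The support of \<open>w\<close> confines the integral to a compact
  set, where \<open>f\<close> is integrable and \<open>w\<close> bounded.\<close>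

lemma locally_integrable_times_integrable:
  fixes f :: "vec3 \<Rightarrow> 'b::euclidean_space" and w :: "vec3 \<Rightarrow> real"
  assumes f: "locally_integrable f" and T: "bounded_linear T"
    and w: "continuous_on UNIV w" and C: "compact C" "\<And>x. x \<notin> C \<Longrightarrow> w x = 0"
  shows "integrable lebesgue (\<lambda>x. T (f x) * w x)"
proof -
  have "integrable lebesgue (\<lambda>x. indicator C x *\<^sub>R f x)"
    using f C(1) unfolding locally_integrable_def set_integrable_def by blast
  then have int: "integrable lebesgue (\<lambda>x. T (indicator C x *\<^sub>R f x))"
    by (rule integrable_bounded_linear[OF T])
  have T0: "T 0 = 0" by (rule linear_0[OF bounded_linear.linear[OF T]])
  have eq: "(\<lambda>x. T (f x) * w x) = (\<lambda>x. T (indicator C x *\<^sub>R f x) * w x)"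
    using C(2) by (auto simp: fun_eq_iff indicator_def T0)
  have "bounded (w ` C)"
    by (rule compact_imp_bounded[OF compact_continuous_image[OF continuous_on_subset[OF w] C(1)]]) simp
  then obtain B where B: "\<forall>y\<in>w ` C. norm y \<le> B"
    unfolding bounded_iff ..
  show ?thesis
    unfolding eq
  proof (rule Bochner_Integration.integrable_bound)
    show "integrable lebesgue (\<lambda>x. B * T (indicator C x *\<^sub>R f x))"
      using int by simp
    show "(\<lambda>x. T (indicator C x *\<^sub>R f x) * w x) \<in> borel_measurable lebesgue"
      by (rule borel_measurable_times[OF borel_measurable_integrable[OF int] continuous_lebesgue_measurable[OF w]])
    show "AE x in lebesgue. norm (T (indicator C x *\<^sub>R f x) * w x) \<le> norm (B * T (indicator C x *\<^sub>R f x))"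
    proof (rule AE_I2)
      fix x
      show "norm (T (indicator C x *\<^sub>R f x) * w x) \<le> norm (B * T (indicator C x *\<^sub>R f x))"
      proof (cases "x \<in> C")
        case True
        then have "\<bar>w x\<bar> \<le> \<bar>B\<bar>" using B by fastforce
        then have "\<bar>w x\<bar> * \<bar>T (indicator C x *\<^sub>R f x)\<bar> \<le> \<bar>B\<bar> * \<bar>T (indicator C x *\<^sub>R f x)\<bar>"
          by (rule mult_right_mono) simp
        then show ?thesis by (simp add: abs_mult mult.commute)
      next
        case False
        then show ?thesis by (simp add: T0)
      qed
    qed
  qed
qed

lemma bounded_linear_entry: "bounded_linear (\<lambda>F :: mat3. F $ i $ \<alpha>)"
  by (intro bounded_linear_compose[OF bounded_linear_vec_nth] bounded_linear_vec_nth)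

lemma test_function_integrable:
  fixes F :: "vec3 \<Rightarrow> mat3" and y :: "vec3 \<Rightarrow> vec3"
  assumes \<phi>: "test_function \<phi>"
  shows "locally_integrable F \<Longrightarrow> integrable lebesgue (\<lambda>x. F x $ i $ \<alpha> * \<phi> x)"
    and "locally_integrable y \<Longrightarrow> integrable lebesgue (\<lambda>x. y x $ i * dir_deriv (axis \<alpha> 1) \<phi> x)"
proof -
  obtain C where C: "compact C" "\<And>x. x \<notin> C \<Longrightarrow> \<phi> x = 0"
    using \<phi> unfolding test_function_def by blast
  show "integrable lebesgue (\<lambda>x. F x $ i $ \<alpha> * \<phi> x)" if "locally_integrable F"
    by (rule locally_integrable_times_integrable[OF that bounded_linear_entry test_function_continuous[OF \<phi>] C])
  have "axis \<alpha> 1 \<in> (Basis :: vec3 set)" by (auto simp: Basis_vec_def)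
  then show "integrable lebesgue (\<lambda>x. y x $ i * dir_deriv (axis \<alpha> 1) \<phi> x)" if "locally_integrable y"
    by (intro locally_integrable_times_integrable[OF that bounded_linear_vec_nth _ C(1)]
        test_function_dir_deriv_continuous[OF \<phi>] dir_deriv_outside_support[OF C])
qed

lemma locally_integrable_add_scaleR:
  assumes "locally_integrable f" "locally_integrable g"
  shows "locally_integrable (\<lambda>x. f x + c *\<^sub>R g x)"
  using assms unfolding locally_integrable_def by (auto intro!: set_integral_add(1) set_integrable_scaleR_right)

lemma has_weak_gradient_add_scaleR:
  assumes y: "has_weak_gradient y F" and u: "has_weak_gradient u E"
  shows "has_weak_gradient (\<lambda>x. y x + c *\<^sub>R u x) (\<lambda>x. F x + c *\<^sub>R E x)"
  unfolding has_weak_gradient_def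
proof (intro conjI allI impI)
  have loc: "locally_integrable y" "locally_integrable F" "locally_integrable u" "locally_integrable E"
    using y u by (auto simp: has_weak_gradient_def)
  then show "locally_integrable (\<lambda>x. y x + c *\<^sub>R u x)" "locally_integrable (\<lambda>x. F x + c *\<^sub>R E x)"
    by (auto intro: locally_integrable_add_scaleR)
  fix \<phi> :: "vec3 \<Rightarrow> real" and i \<alpha> assume \<phi>: "test_function \<phi>"
  let ?d = "dir_deriv (axis \<alpha> 1) \<phi>"
  note int = test_function_integrable[OF \<phi>]
  have "(LINT x|lebesgue. (F x + c *\<^sub>R E x) $ i $ \<alpha> * \<phi> x)
      = (LINT x|lebesgue. F x $ i $ \<alpha> * \<phi> x + c * (E x $ i $ \<alpha> * \<phi> x))"
    by (simp add: algebra_simps)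
  also have "\<dots> = (LINT x|lebesgue. F x $ i $ \<alpha> * \<phi> x) + c * (LINT x|lebesgue. E x $ i $ \<alpha> * \<phi> x)"
    using int(1)[OF loc(2)] int(1)[OF loc(4)] by simp
  also have "\<dots> = - ((LINT x|lebesgue. y x $ i * ?d x) + c * (LINT x|lebesgue. u x $ i * ?d x))"
    using y u \<phi> by (simp add: has_weak_gradient_def)
  also have "(LINT x|lebesgue. y x $ i * ?d x) + c * (LINT x|lebesgue. u x $ i * ?d x)
      = (LINT x|lebesgue. y x $ i * ?d x + c * (u x $ i * ?d x))"
    using int(2)[OF loc(1)] int(2)[OF loc(3)] by simp
  also have "\<dots> = (LINT x|lebesgue. (y x + c *\<^sub>R u x) $ i * ?d x)"
    by (simp add: algebra_simps)
  finally show "(LINT x|lebesgue. (F x + c *\<^sub>R E x) $ i $ \<alpha> * \<phi> x)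
      = - (LINT x|lebesgue. (y x + c *\<^sub>R u x) $ i * ?d x)" .
qed

text \<open>A weak gradient enters only through integrals. This is needed because the discrete
  update determines the new matrix field only almost everywhere.\<close>

lemma has_weak_gradient_cong_AE:
  assumes y: "has_weak_gradient y F" and E: "locally_integrable E" and ae: "AE x in lebesgue. F x = E x"
  shows "has_weak_gradient y E"
proof -
  have F: "locally_integrable F" using y by (simp add: has_weak_gradient_def)
  have "(LINT x|lebesgue. E x $ i $ \<alpha> * \<phi> x) = (LINT x|lebesgue. F x $ i $ \<alpha> * \<phi> x)"
    if \<phi>: "test_function \<phi>" for \<phi> i \<alpha>
    using ae borel_measurable_integrable[OF test_function_integrable(1)[OF \<phi> F]]
      borel_measurable_integrable[OF test_function_integrable(1)[OF \<phi> E]]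
    by (intro integral_cong_AE) (auto elim: eventually_mono)
  with y E show ?thesis
    by (simp add: has_weak_gradient_def)
qed

lemma has_weak_gradient_U_h:
  assumes T: "torus_triangulation \<T>" and v: "v \<in> U_h \<T> k"
  shows "has_weak_gradient v (nabla v)"
  unfolding has_weak_gradient_def
proof (intro conjI allI impI)
  have cont: "continuous_on UNIV v" using v by (simp add: U_h_def)
  have "pw_poly \<T> k (\<lambda>x. v x \<bullet> b)" if "b \<in> Basis" for b
  proof (rule pw_polyI)
    fix K assume K: "K \<in> \<T>"
    obtain i where b: "b = axis i 1" using \<open>b \<in> Basis\<close> by (auto simp: Basis_vec_def)
    obtain q where "poly_fun k q" "\<And>x. x \<in> K \<Longrightarrow> v x $ i = q x"
      using U_h_component_poly[OF v K, of i] by metis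
    then show "\<exists>q. poly_fun k q \<and> (AE x in lebesgue. x \<in> K \<longrightarrow> v x \<bullet> b = q x)"
      unfolding b inner_axis by (intro exI[of _ q]) simp
  qed
  then show "locally_integrable v" by (rule pw_poly_locally_integrable[OF T])
  have "pw_poly \<T> (k - 1) (\<lambda>x. nabla v x \<bullet> b)" if "b \<in> Basis" for b
  proof -
    obtain i \<alpha> where b: "b = axis i (axis \<alpha> 1)" using \<open>b \<in> Basis\<close> unfolding mat3_Basis_iff by blast
    show ?thesis using pw_poly_nabla[OF T v, of i \<alpha>] unfolding b inner_axis by simp
  qed
  then show "locally_integrable (nabla v)" by (rule pw_poly_locally_integrable[OF T])
  fix \<phi> :: "vec3 \<Rightarrow> real" and i \<alpha> assume \<phi>: "test_function \<phi>"
  show "(LINT x|lebesgue. nabla v x $ i $ \<alpha> * \<phi> x) = - (LINT x|lebesgue. v x $ i * dir_deriv (axis \<alpha> 1) \<phi> x)"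
  proof (rule weak_derivative_if_AE_derivative[OF _ _ _ _ \<phi>])
    show "continuous_on UNIV (\<lambda>x. v x $ i)" by (intro continuous_intros cont)
    show "(\<lambda>x. nabla v x $ i $ \<alpha>) \<in> borel_measurable lebesgue"
      by (rule pw_poly_measurable[OF T pw_poly_nabla[OF T v]])
    show "\<exists>L. \<forall>x\<in>cball 0 R. \<forall>y\<in>cball 0 R. \<bar>v x $ i - v y $ i\<bar> \<le> L * norm (x - y)" for R
      by (rule U_h_locally_lipschitz[OF T v])
    show "AE x in lebesgue. ((\<lambda>s. (v (x + s *\<^sub>R axis \<alpha> 1) $ i - v x $ i) / s) \<longlongrightarrow> nabla v x $ i $ \<alpha>) (at 0)"
      using AE_U_h_differentiable[OF T v]
    proof (rule eventually_mono)
      fix x assume "v differentiable (at x)"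
      then obtain D where D: "(v has_derivative D) (at x)" unfolding differentiable_def ..
      have "((\<lambda>x. v x $ i) has_derivative (\<lambda>h. D h $ i)) (at x)"
        by (rule bounded_linear.has_derivative[OF bounded_linear_vec_nth D])
      from difference_quotient_tendsto[OF this, of "axis \<alpha> 1"]
      show "((\<lambda>s. (v (x + s *\<^sub>R axis \<alpha> 1) $ i - v x $ i) / s) \<longlongrightarrow> nabla v x $ i $ \<alpha>) (at 0)"
        unfolding nabla_nth[OF D] .
    qed
    show "axis \<alpha> 1 \<in> (Basis :: vec3 set)" by (auto simp: Basis_vec_def)
  qed
qed

lemma zero_L2_torus: "(\<lambda>x. 0) \<in> L2_torus"
  by (simp add: L2_torus_def periodic_def set_integrable_def)

lemma DPhi_nabla_in_H_h:
  assumes T: "torus_triangulation \<T>" and F: "F \<in> HF_h \<T> k" and v: "v \<in> U_h \<T> k"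
  shows "(\<lambda>x. DPhi (F x) (nabla v x)) \<in> H_h \<T> k"
proof -
  have pF: "periodic F" and F': "\<And>i \<alpha>. pw_poly \<T> (k - 1) (\<lambda>x. F x $ i $ \<alpha>)"
    using F unfolding HF_h_def L2_piecewise_poly_matrix_iff[OF T] by auto
  \<comment> \<open>\<open>H_h\<close> demands periodicity at every point, including faces where the
    values of \<open>nabla v\<close> are unspecified.\<close>
  have pv: "periodic (nabla v)"
    using v by (intro periodic_nabla) (simp add: U_h_def)
  note v' = pw_poly_nabla[OF T v]
  show ?thesis
    unfolding DPhi_eq H_h_iff HF_h_def HZ_h_def Hw_h_def
      L2_piecewise_poly_matrix_iff[OF T] L2_piecewise_poly_real_iff[OF T]
    using pF pv by (intro conjI allI v' pw_poly_dcof[OF F' v'] pw_poly_ddet[OF F' v'])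
      (simp_all add: periodic_def)
qed

theorem mainTheorem2:
  fixes G :: "state \<Rightarrow> real"
    and \<T> :: "vec3 set set"
    and k :: nat
    and \<tau> :: real
    and v0 v1 :: "vec3 \<Rightarrow> vec3"
    and F0 F1 Z0 Z1 :: "vec3 \<Rightarrow> mat3"
    and w0 w1 :: "vec3 \<Rightarrow> real"
    and \<xi>0 \<xi>1 :: "vec3 \<Rightarrow> state"
  assumes "stored_energy G"
    and "torus_triangulation \<T>"
    and "k \<ge> 1"
    and "\<tau> > 0"
    and "\<xi>0 = (\<lambda>x. (F0 x, Z0 x, w0 x))"
    and "\<xi>1 = (\<lambda>x. (F1 x, Z1 x, w1 x))"
    and "v0 \<in> U_h \<T> k" and "\<xi>0 \<in> H_h \<T> k"
    and "v1 \<in> U_h \<T> k" and "\<xi>1 \<in> H_h \<T> k"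
    and "solves_scheme G \<T> k \<tau> v0 \<xi>0 v1 \<xi>1"
  shows "L2_eq (\<lambda>x. (1 / \<tau>) *\<^sub>R (\<xi>1 x - \<xi>0 x) - DPhi (F0 x) (nabla v1 x)) (\<lambda>x. 0)
       \<and> L2_eq (\<lambda>x. (1 / \<tau>) *\<^sub>R (F1 x - F0 x) - nabla v1 x) (\<lambda>x. 0)
       \<and> (is_gradient F0 \<longrightarrow> is_gradient F1)"
proof -
  note T = assms(2)
  have F: "F0 \<in> HF_h \<T> k" "F1 \<in> HF_h \<T> k"
    using assms(8,10) unfolding assms(5,6) H_h_iff by auto
  let ?d\<xi> = "\<lambda>x. (1 / \<tau>) *\<^sub>R (\<xi>1 x - \<xi>0 x)"
  let ?D = "\<lambda>x. DPhi (F0 x) (nabla v1 x)"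
  define r where "r = (\<lambda>x. ?d\<xi> x - ?D x)"
  have d\<xi>: "?d\<xi> \<in> H_h \<T> k" and D: "?D \<in> H_h \<T> k"
    by (rule H_h_scaleR[OF T H_h_diff[OF T assms(10,8)]], rule DPhi_nabla_in_H_h[OF T F(1) assms(9)])
  have r: "r \<in> H_h \<T> k"
    unfolding r_def by (rule H_h_diff[OF T d\<xi> D])
  have "L2_inner ?d\<xi> r = L2_inner ?D r"
    using assms(11) r unfolding solves_scheme_def by (simp add: assms(5))
  then have "L2_inner r r = 0"
    using L2_inner_diff_left[OF H_h_L2_torus[OF d\<xi>] H_h_L2_torus[OF D] H_h_L2_torus[OF r]]
    unfolding r_def by simp
  then have ae: "AE x in lebesgue. r x = 0"
    by (rule AE_zero_if_L2_inner_self_zero[OF H_h_L2_torus[OF r]])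
  have state: "L2_eq (\<lambda>x. ?d\<xi> x - ?D x) (\<lambda>x. 0)"
    using H_h_L2_torus[OF r] ae zero_L2_torus unfolding L2_eq_def r_def by simp
  \<comment> \<open>Only the first slot of \<open>r\<close> is read off; by \<open>DPhi_eq\<close>
    it contains \<open>nabla v1\<close> itself.\<close>
  have aeF: "AE x in lebesgue. (1 / \<tau>) *\<^sub>R (F1 x - F0 x) - nabla v1 x = 0"
    using ae by (rule eventually_mono) (simp add: r_def assms(5,6) DPhi_eq zero_prod_def)
  \<comment> \<open>\<open>L2_eq\<close> includes membership in \<open>L2_torus\<close>; it is
    inherited from the first component of \<open>r\<close>, which lies in
    \<open>HF_h\<close>.\<close>
  have "(\<lambda>x. (1 / \<tau>) *\<^sub>R (F1 x - F0 x) - nabla v1 x) \<in> L2_torus"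
    using r unfolding r_def assms(5,6) DPhi_eq diff_Pair scaleR_Pair H_h_iff HF_h_def L2_piecewise_poly_def by simp
  then have F_eq: "L2_eq (\<lambda>x. (1 / \<tau>) *\<^sub>R (F1 x - F0 x) - nabla v1 x) (\<lambda>x. 0)"
    using aeF zero_L2_torus unfolding L2_eq_def by simp
  have "is_gradient F1" if "is_gradient F0"
  proof -
    obtain y where y: "has_weak_gradient y F0"
      using \<open>is_gradient F0\<close> unfolding is_gradient_def ..
    have "locally_integrable F1"
      using F(2) unfolding HF_h_def L2_piecewise_poly_iff[OF T] by (blast intro: pw_poly_locally_integrable[OF T])
    \<comment> \<open>The update solved for \<open>F1\<close>, which is possible because
      \<open>\<tau>\<close> is nonzero.\<close>
    moreover have "AE x in lebesgue. F0 x + \<tau> *\<^sub>R nabla v1 x = F1 x"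
      using aeF
    proof (rule eventually_mono)
      fix x assume "(1 / \<tau>) *\<^sub>R (F1 x - F0 x) - nabla v1 x = 0"
      then have "nabla v1 x = (1 / \<tau>) *\<^sub>R (F1 x - F0 x)" by simp
      with assms(4) show "F0 x + \<tau> *\<^sub>R nabla v1 x = F1 x" by simp
    qed
    ultimately have "has_weak_gradient (\<lambda>x. y x + \<tau> *\<^sub>R v1 x) F1"
      by (rule has_weak_gradient_cong_AE[OF has_weak_gradient_add_scaleR[OF y has_weak_gradient_U_h[OF T assms(9)]]])
    then show ?thesis
      unfolding is_gradient_def by (rule exI[where x = "\<lambda>x. y x + \<tau> *\<^sub>R v1 x"])
  qed
  with state F_eq show ?thesis by blast
qed

end
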